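(* Let $r\in\mathbb N$, $N=\{1,\dots,r\}$, and let $I$ be a countable (finite or infinite) set with at least two elements. Let $\gamma=(\gamma^i)_{i\in I}$ be a family of maps $\gamma^i\colon\mathbb R^N\to\mathbb R^N$ and let $T\subseteq\mathbb R^N$ be such that: (H1) for every $i\in I$ there exist $\alpha^i=(\alpha^i_n)_{n\in N}\in(0,1)^N$ and $a^i=(a^i_n)_{n\in N}\in\mathbb R^N$ such that $\sup_{i\in I,n\in N}\alpha^i_n<1$ and $\gamma^i(x)=(\alpha^i_nx_n+a^i_n)_{n\in N}$ for every $x\in\mathbb R^N$; (H2) $T$ is a compact admissible set with $\mu(T)>0$ such that $\mu(\gamma^i(T)\cap\gamma^j(T))=0$ for $i\neq j$, $\mu\big(T\,\triangle\,\bigcup_{i\in I}\gamma^i(T)\big)=0$, and $T=\overline{\bigcup_{i\in I}\gamma^i(T)}$; (H3) $T\subseteq[0,\infty)^N$ and $Q(0,x)\subseteq T$ for every $x\in T$. Let $\nu$ be a $\mathrm C^N$-measure on $T$. Then the following conditions are equivalent: (i) $\nu$ is $g_\gamma$-invariant, i.e. $\nu(E)=\nu(g_\gamma^{-1}(E))$ for every Borel set $E\subseteq T$; (ii) $\mathbb Md_\nu=d_\nu$ on $T$; (iii) there exists $\lambda\ge0$ such that $\nu=\lambda\mu$ (with $\mu$ the Lebesgue measure on $T$).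
   Context: $\mu$ is Lebesgue measure on $\mathbb R^N$; $\triangle$ is symmetric difference. For $a,b\in[0,\infty)^N$, $Q(a,b)=\prod_{n\in N}[a_n,b_n)$, where $[x,y)$ denotes the segment joining $x$ and $y$ with the point $y$ removed. For $x,y\in\mathbb R^N$ and $M\subseteq N$, $\pi_M(x,y)$ is the point with $n$-th coordinate $x_n$ if $n\in M$ and $y_n$ if $n\in N\setminus M$; $\Pi(x,y)=\prod_{n\in N}\{x_n,y_n\}$. For $f\colon Y\to\mathbb R$ with $\Pi(x,y)\subseteq Y\subseteq\mathbb R^N$, $\square f(x,y)=\sum_{M\subseteq N}(-1)^{|M|}f(\pi_M(x,y))$. A set $Y\subseteq\mathbb R^N$ is admissible if $0\in Y$ and $\Pi(\gamma^i(0),\gamma^i(x))\subseteq Y$ for all $x\in Y$ and $i\in I$. For $f\colon T\to\mathbb R$ such that the series converges for every $x\in T$, $\mathbb Mf(x)=\sum_{i\in I}\square f(\gamma^i(0),\gamma^i(x))$. The multivariate distribution of a Borel measure $\nu$ on $T$ is the function $d_\nu\colon T\to\mathbb R$, $d_\nu(x)=\nu(Q(0,x))$. $\nu$ is a $\mathrm C^N$-measure if $d_\nu$ is a $\mathrm C^N$-function, i.e. $d_\nu$ has an extension $\widetilde f\colon\mathbb R^N\to\mathbb R$ such that for every $M=\{m_1<\dots<m_p\}\subseteq N$ the mixed partial derivative $\partial_{m_1}\cdots\partial_{m_p}\widetilde f$ (equal to $\widetilde f$ if $M=\emptyset$) exists at each point and is continuous on $\mathbb R^N$. The map $g_\gamma\colon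 T\to T$ is defined as follows. Put $A=T\setminus\bigcup_{i,j\in I,\,i\ne j}(\gamma^i)^{-1}(\gamma^i(T)\cap\gamma^j(T))$ and $A^i=\gamma^i(A)$ for $i\in I$; the sets $A^i$ are pairwise disjoint. Then $g_\gamma(x)=(\gamma^i)^{-1}(x)$ if $x\in A^i$ for some $i\in I$, and $g_\gamma(x)=0$ if $x\in T\setminus\bigcup_{i\in I}A^i$. It is a Borel function.
   Formalization: Added hypothesis: ν gives mass zero to the part of T not covered by the boxes Q(0,x), x∈T; without it the claim fails, e.g. T=[0,1], maps x/2 and (x+1)/2, ν=μ+δ_1 satisfies (ii) but neither (i) nor (iii). *)

theory Defs
  imports "HOL-Analysis.Analysis"
begin

text \<open>
  Coordinates are indexed by a finite linearly ordered type \<open>'n\<close>, which plays the role of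
  \<open>{1, \<dots>, r}\<close>; the order is only needed to fix the order of differentiation in mixed partial
  derivatives.
\<close>

definition Qbox :: "real^'n \<Rightarrow> real^'n \<Rightarrow> (real^'n) set" where
  "Qbox a b = {z. \<forall>n. z $ n \<in> closed_segment (a $ n) (b $ n) - {b $ n}}"

definition pi_pt :: "'n set \<Rightarrow> real^'n \<Rightarrow> real^'n \<Rightarrow> real^'n" where
  "pi_pt M x y = (\<chi> n. if n \<in> M then x $ n else y $ n)"

definition corners :: "real^'n \<Rightarrow> real^'n \<Rightarrow> (real^'n) set" where
  "corners x y = {z. \<forall>n. z $ n \<in> {x $ n, y $ n}}"

definition square :: "(real^'n \<Rightarrow> real) \<Rightarrow> real^'n \<Rightarrow> real^'n \<Rightarrow> real" where
  "square f x y = (\<Sum>M\<in>Pow UNIV. (- 1) ^ card M * f (pi_pt M x y))"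

definition admissible :: "'i set \<Rightarrow> ('i \<Rightarrow> real^'n \<Rightarrow> real^'n) \<Rightarrow> (real^'n) set \<Rightarrow> bool" where
  "admissible I \<gamma> Y \<longleftrightarrow> 0 \<in> Y \<and> (\<forall>x\<in>Y. \<forall>i\<in>I. corners (\<gamma> i 0) (\<gamma> i x) \<subseteq> Y)"

text \<open>
  \<open>I\<close> carries no order, so the series over \<open>I\<close> is an unordered sum. \<open>Mop\<close> is meaningful for \<open>f\<close>
  on \<open>T\<close> only if \<open>Mop_converges I \<gamma> T f\<close>.
\<close>

definition Mop_converges ::
    "'i set \<Rightarrow> ('i \<Rightarrow> real^'n \<Rightarrow> real^'n) \<Rightarrow> (real^'n) set \<Rightarrow> (real^'n \<Rightarrow> real) \<Rightarrow> bool" where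
  "Mop_converges I \<gamma> T f \<longleftrightarrow> (\<forall>x\<in>T. (\<lambda>i. square f (\<gamma> i 0) (\<gamma> i x)) summable_on I)"

definition Mop ::
    "'i set \<Rightarrow> ('i \<Rightarrow> real^'n \<Rightarrow> real^'n) \<Rightarrow> (real^'n \<Rightarrow> real) \<Rightarrow> real^'n \<Rightarrow> real" where
  "Mop I \<gamma> f x = (\<Sum>\<^sub>\<infinity>i\<in>I. square f (\<gamma> i 0) (\<gamma> i x))"

text \<open>
  \<open>has_mixed_partial [m1, \<dots>, mp] F G\<close>: the iterated partial derivative of \<open>F\<close>, first in direction
  \<open>mp\<close> and last in direction \<open>m1\<close>, exists everywhere and equals \<open>G\<close>.
\<close>

primrec has_mixed_partial :: "'n list \<Rightarrow> (real^'n \<Rightarrow> real) \<Rightarrow> (real^'n \<Rightarrow> real) \<Rightarrow> bool" where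
  "has_mixed_partial [] F G \<longleftrightarrow> G = F"
| "has_mixed_partial (m # ms) F G \<longleftrightarrow>
     (\<exists>H. has_mixed_partial ms F H \<and>
       (\<forall>x. ((\<lambda>t. H (x + t *\<^sub>R axis m 1)) has_real_derivative G x) (at 0)))"

definition CN_function_on ::
    "(real, 'n::{finite,linorder}) vec set \<Rightarrow> ((real, 'n) vec \<Rightarrow> real) \<Rightarrow> bool" where
  "CN_function_on T f \<longleftrightarrow>
     (\<exists>F. (\<forall>x\<in>T. F x = f x) \<and>
       (\<forall>M. \<exists>G. has_mixed_partial (sorted_list_of_set M) F G \<and> continuous_on UNIV G))"

definition borel_measure_on :: "(real^'n) set \<Rightarrow> (real^'n) measure \<Rightarrow> bool" where
  "borel_measure_on T \<nu> \<longleftrightarrow> sets \<nu> = sets (restrict_space borel T)"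

text \<open>
  The distribution function of a measure on \<open>T\<close> does not see any mass on the part of \<open>T\<close> that is
  not covered by the half-open boxes \<open>Qbox 0 x\<close>, \<open>x \<in> T\<close> (for \<open>T = {0..1}\<close>: the point \<open>1\<close>);
  hence \<open>no_outer_mass\<close>, which says that there is none. For \<open>T = {0..1}\<close>, \<open>\<gamma> 0 x = x / 2\<close>,
  \<open>\<gamma> 1 x = (x + 1) / 2\<close>, the sum of Lebesgue measure and the unit mass at \<open>1\<close> has the
  distribution function \<open>x\<close> of Lebesgue measure, but is not a multiple of Lebesgue measure.
\<close>

definition distrib :: "(real^'n) measure \<Rightarrow> real^'n \<Rightarrow> real" where
  "distrib \<nu> x = measure \<nu> (Qbox 0 x)"

definition no_outer_mass :: "(real^'n) set \<Rightarrow> (real^'n) measure \<Rightarrow> bool" where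
  "no_outer_mass T \<nu> \<longleftrightarrow> emeasure \<nu> (T - (\<Union>x\<in>T. Qbox 0 x)) = 0"

text \<open>The finiteness condition says that the distribution function is real-valued on \<open>T\<close>.\<close>

definition CN_measure_on :: "(real, 'n::{finite,linorder}) vec set \<Rightarrow> (real, 'n) vec measure \<Rightarrow> bool" where
  "CN_measure_on T \<nu> \<longleftrightarrow> borel_measure_on T \<nu> \<and>
     (\<forall>x\<in>T. emeasure \<nu> (Qbox 0 x) < \<infinity>) \<and> CN_function_on T (distrib \<nu>)"

definition Aset :: "'i set \<Rightarrow> ('i \<Rightarrow> real^'n \<Rightarrow> real^'n) \<Rightarrow> (real^'n) set \<Rightarrow> (real^'n) set" where
  "Aset I \<gamma> T = T - (\<Union>i\<in>I. \<Union>j\<in>I - {i}. \<gamma> i -` (\<gamma> i ` T \<inter> \<gamma> j ` T))"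

text \<open>The sets \<open>\<gamma> i ` Aset I \<gamma> T\<close>, \<open>i \<in> I\<close>, are pairwise disjoint, so the \<open>THE\<close> below is proper.\<close>

definition gmap ::
    "'i set \<Rightarrow> ('i \<Rightarrow> real^'n \<Rightarrow> real^'n) \<Rightarrow> (real^'n) set \<Rightarrow> real^'n \<Rightarrow> real^'n" where
  "gmap I \<gamma> T x =
     (if \<exists>i\<in>I. x \<in> \<gamma> i ` Aset I \<gamma> T
      then inv (\<gamma> (THE i. i \<in> I \<and> x \<in> \<gamma> i ` Aset I \<gamma> T)) x else 0)"

definition invariant_on ::
    "(real^'n) set \<Rightarrow> (real^'n \<Rightarrow> real^'n) \<Rightarrow> (real^'n) measure \<Rightarrow> bool" where
  "invariant_on T g \<nu> \<longleftrightarrow>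
     (\<forall>E\<in>sets borel. E \<subseteq> T \<longrightarrow> emeasure \<nu> E = emeasure \<nu> {x \<in> T. g x \<in> E})"

end

theory Submission
  imports Defs
begin

text \<open>
  Let \<open>h\<close> be the continuous mixed partial derivative of (an extension of) \<open>d\<^sub>\<nu>\<close>. Then \<open>\<nu> = h \<mu>\<close> on the
  union \<open>U\<close> of the boxes \<open>Q(0, x)\<close>, and \<open>T - U\<close> is a null set of both measures; in particular
  \<open>\<nu>\<close> vanishes on Lebesgue null sets. Hence \<open>\<nu>(g\<^sup>-\<^sup>1(E)) = \<Sum>\<^sub>i \<nu>(\<gamma>\<^sup>i(E))\<close>. As \<open>\<nu>(\<gamma>\<^sup>i(Q(0, x)))\<close> is
  the mixed difference of \<open>d\<^sub>\<nu>\<close> over \<open>\<gamma>\<^sup>i(0), \<gamma>\<^sup>i(x)\<close>, condition (ii) says that \<open>\<nu>\<close> and its image under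
  \<open>g\<close> agree on the boxes \<open>Q(0, x)\<close>.

  If so, fix some \<open>i\<close> and let \<open>k\<close> be \<open>max h - h\<close> or \<open>h - min h\<close>, the extrema being taken over the
  closure of \<open>U\<close>. Since \<open>\<mu>\<close> is invariant too and \<open>k \<ge> 0\<close>, invariance yields
  \<open>k \<ge> p\<^sub>i (k \<circ> \<gamma>\<^sup>i)\<close> with \<open>p\<^sub>i = \<Prod>\<^sub>n \<alpha>\<^sup>i\<^sub>n > 0\<close>. So the zeros of \<open>k\<close> are mapped to zeros by \<open>\<gamma>\<^sup>i\<close> and, by
  iteration, the fixed point of \<open>\<gamma>\<^sup>i\<close> is a zero. It is therefore both a maximum and a minimum
  point of \<open>h\<close>, and \<open>h\<close> is constant.
\<close>

section \<open>Mixed differences as integrals\<close>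

definition upd :: "real^'n \<Rightarrow> 'n \<Rightarrow> real \<Rightarrow> real^'n" where
  "upd x k t = (\<chi> n. if n = k then t else x $ n)"

lemma upd_nth [simp]: "upd x k t $ n = (if n = k then t else x $ n)"
  by (simp add: upd_def)

text \<open>The mixed difference in the coordinates of \<open>S\<close> alone, the remaining ones
  being frozen at \<open>x\<close>. Letting \<open>S\<close> grow by one coordinate at a time makes
  inductions possible; for \<open>S = UNIV\<close> nothing depends on \<open>x\<close>.\<close>

definition partial_square ::
    "'n set \<Rightarrow> (real^'n \<Rightarrow> real) \<Rightarrow> real^'n \<Rightarrow> real^'n \<Rightarrow> real^'n \<Rightarrow> real" where
  "partial_square S F a b x =
     (\<Sum>M\<in>Pow S. (- 1) ^ card M * F (\<chi> n. if n \<in> M then a $ n else if n \<in> S then b $ n else x $ n))"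

lemma square_eq_partial_square: "square F a b = partial_square UNIV F a b x"
proof -
  have "(\<chi> n. if n \<in> M then a $ n else b $ n) =
      (\<chi> n. if n \<in> M then a $ n else if n \<in> UNIV then b $ n else x $ n)" for M
    by (simp only: UNIV_I if_True)
  then show ?thesis unfolding square_def partial_square_def pi_pt_def by metis
qed

lemma partial_square_empty [simp]: "partial_square {} F a b x = F x"
  by (simp add: partial_square_def)

text \<open>The subsets of \<open>insert k S\<close> fall into those without \<open>k\<close> and
  those with \<open>k\<close>. The second kind has one more element, hence the opposite sign, and
  takes its \<open>k\<close>-th coordinate from \<open>a\<close> instead of
  \<open>b\<close>.\<close>

lemma partial_square_insert:
  fixes k :: "'n::finite"
  assumes "k \<notin> S"
  shows "partial_square (insert k S) F a b x =
    partial_square S F a b (upd x k (b $ k)) - partial_square S F a b (upd x k (a $ k))"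
proof -
  let ?P = "\<lambda>S x M. (\<chi> n. if n \<in> M then a $ n else if n \<in> S then b $ n else x $ n)"
  have inj: "inj_on (insert k) (Pow S)"
    using assms by (intro inj_onI) (auto simp: insert_ident)
  have 1: "?P (insert k S) x M = ?P S (upd x k (b $ k)) M" if "M \<in> Pow S" for M
    using assms that by (auto simp: vec_eq_iff)
  have 2: "?P (insert k S) x (insert k M) = ?P S (upd x k (a $ k)) M" if "M \<in> Pow S" for M
    using assms that by (auto simp: vec_eq_iff)
  have 3: "card (insert k M) = Suc (card M)" if "M \<in> Pow S" for M
    using assms that by (subst card_insert_disjoint) auto
  have "partial_square (insert k S) F a b x =
      (\<Sum>M\<in>Pow S. (- 1) ^ card M * F (?P (insert k S) x M)) +
      (\<Sum>M\<in>insert k ` Pow S. (- 1) ^ card M * F (?P (insert k S) x M))"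
    unfolding partial_square_def Pow_insert using assms
    by (subst sum.union_disjoint) auto
  also have "(\<Sum>M\<in>insert k ` Pow S. (- 1) ^ card M * F (?P (insert k S) x M)) =
      (\<Sum>M\<in>Pow S. (- 1) ^ card (insert k M) * F (?P (insert k S) x (insert k M)))"
    using inj by (simp add: sum.reindex)
  also have "\<dots> = - partial_square S F a b (upd x k (a $ k))"
    unfolding partial_square_def sum_negf[symmetric]
    by (rule sum.cong[OF refl], subst 2, assumption, subst 3, assumption, simp)
  also have "(\<Sum>M\<in>Pow S. (- 1) ^ card M * F (?P (insert k S) x M)) =
      partial_square S F a b (upd x k (b $ k))"
    unfolding partial_square_def by (rule sum.cong[OF refl], subst 1, assumption, simp)
  finally show ?thesis by simp
qed

lemma partial_square_cong:
  assumes "\<And>n. n \<in> S \<Longrightarrow> a $ n = a' $ n" "\<And>n. n \<in> S \<Longrightarrow> b $ n = b' $ n"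
    "\<And>n. n \<notin> S \<Longrightarrow> x $ n = x' $ n"
  shows "partial_square S F a b x = partial_square S F a' b' x'"
  unfolding partial_square_def
  by (rule sum.cong[OF refl], rule arg_cong2[where f = "(*)", OF refl], rule arg_cong[where f = F])
    (use assms in \<open>auto simp: vec_eq_iff\<close>)

lemma square_split_coordinate:
  fixes k :: "'n::finite"
  shows "square F a b =
    partial_square (UNIV - {k}) F a b (upd x k (b $ k)) - partial_square (UNIV - {k}) F a b (upd x k (a $ k))"
  using partial_square_insert[of k "UNIV - {k}" F a b x]
  by (simp add: square_eq_partial_square[of F a b x] insert_absorb)

lemma square_degenerate:
  assumes "a $ k = b $ k"
  shows "square F a b = 0"
  by (simp add: square_split_coordinate[of F a b k 0] assms)

text \<open>Split in coordinate \<open>k\<close>, each mixed difference is a difference of values of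
  one and the same function of that coordinate, so the contributions at \<open>c\<close>
  cancel.\<close>

lemma square_additive:
  "square F a b = square F a (upd b k c) + square F (upd a k c) b"
proof -
  have "partial_square (UNIV - {k}) F a (upd b k c) y = partial_square (UNIV - {k}) F a b y"
    "partial_square (UNIV - {k}) F (upd a k c) b y = partial_square (UNIV - {k}) F a b y" for y
    by (rule partial_square_cong; simp)+
  then show ?thesis
    by (simp add: square_split_coordinate[of _ _ _ k 0])
qed

section \<open>A mean value theorem for mixed differences\<close>

lemma has_mixed_partial_snoc:
  "has_mixed_partial (ms @ [m]) F G \<longleftrightarrow>
     (\<exists>F'. (\<forall>x. ((\<lambda>t. F (x + t *\<^sub>R axis m 1)) has_real_derivative F' x) (at 0)) \<and>
       has_mixed_partial ms F' G)"
proof (induction ms arbitrary: G)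
  case Nil
  show ?case by auto
next
  case (Cons k ms)
  show ?case by (auto simp: Cons.IH)
qed

lemma upd_eq_plus_axis: "upd x k s = upd x k t + (s - t) *\<^sub>R axis k 1"
  by (auto simp: vec_eq_iff axis_def)

text \<open>Induction from the right end of the list, since the last direction is the one in which
  \<open>F\<close> itself is differentiated first. The one-dimensional mean value theorem in that
  coordinate fixes it at some \<open>t\<close> and replaces \<open>F\<close> by its partial
  derivative; the induction hypothesis, started at \<open>upd x m t\<close>, finds the other
  coordinates of \<xi>.\<close>

lemma partial_square_mvt:
  fixes F G :: "real^'n \<Rightarrow> real"
  assumes "has_mixed_partial ms F G" "distinct ms" "\<And>n. a $ n \<le> b $ n"
  shows "\<exists>\<xi>. (\<forall>n. n \<notin> set ms \<longrightarrow> \<xi> $ n = x $ n) \<and> (\<forall>n\<in>set ms. a $ n \<le> \<xi> $ n \<and> \<xi> $ n \<le> b $ n) \<and>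
    partial_square (set ms) F a b x = (\<Prod>n\<in>set ms. b $ n - a $ n) * G \<xi>"
  using assms(1,2)
proof (induction ms arbitrary: F x rule: rev_induct)
  case Nil
  then show ?case by auto
next
  case (snoc m ms)
  then obtain F' where F': "\<And>x. ((\<lambda>t. F (x + t *\<^sub>R axis m 1)) has_real_derivative F' x) (at 0)"
      "has_mixed_partial ms F' G"
    unfolding has_mixed_partial_snoc by blast
  have m: "m \<notin> set ms" and dist: "distinct ms" using snoc.prems by auto
  have F_upd: "((\<lambda>t. F (upd y m t)) has_real_derivative F' (upd y m t)) (at t)" for y t
  proof -
    have "((\<lambda>s. F (upd y m t + (s - t) *\<^sub>R axis m 1)) has_real_derivative F' (upd y m t)) (at t)"
      using F'(1)[of "upd y m t"] DERIV_shift[of "\<lambda>s. F (upd y m t + (s - t) *\<^sub>R axis m 1)" "F' (upd y m t)" 0 t]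
      by simp
    then show ?thesis by (simp flip: upd_eq_plus_axis)
  qed
  have deriv: "((\<lambda>t. partial_square (set ms) F a b (upd x m t)) has_real_derivative
      partial_square (set ms) F' a b (upd x m t)) (at t)" for t
  proof -
    have *: "(\<chi> n. if n \<in> M then a $ n else if n \<in> set ms then b $ n else upd x m s $ n) =
        upd (\<chi> n. if n \<in> M then a $ n else if n \<in> set ms then b $ n else x $ n) m s"
      if "M \<in> Pow (set ms)" for M s
      using m that by (auto simp: vec_eq_iff)
    have eq: "partial_square (set ms) H a b (upd x m s) = (\<Sum>M\<in>Pow (set ms). (- 1) ^ card M *
        H (upd (\<chi> n. if n \<in> M then a $ n else if n \<in> set ms then b $ n else x $ n) m s))" for H s
      unfolding partial_square_def by (rule sum.cong[OF refl], subst *, assumption, rule refl)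
    show ?thesis
      unfolding eq by (intro DERIV_sum DERIV_cmult F_upd)
  qed
  have split: "partial_square (set (ms @ [m])) F a b x =
      partial_square (set ms) F a b (upd x m (b $ m)) - partial_square (set ms) F a b (upd x m (a $ m))"
    using partial_square_insert[OF m] by simp
  obtain t where t: "a $ m \<le> t" "t \<le> b $ m" "partial_square (set (ms @ [m])) F a b x =
      (b $ m - a $ m) * partial_square (set ms) F' a b (upd x m t)"
  \<comment> \<open>The mean value theorem requires a side of positive length; on a degenerate side
    both members of the equation vanish.\<close>
  proof (cases "a $ m = b $ m")
    case True
    then show ?thesis using that[of "a $ m"] unfolding split by simp
  next
    case False
    then have "a $ m < b $ m" using assms(3)[of m] by simp
    from MVT2[OF this deriv] obtain t where "a $ m < t" "t < b $ m"
      "partial_square (set ms) F a b (upd x m (b $ m)) - partial_square (set ms) F a b (upd x m (a $ m)) =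
        (b $ m - a $ m) * partial_square (set ms) F' a b (upd x m t)" by blast
    then show ?thesis using that[of t] unfolding split by simp
  qed
  obtain \<xi> where \<xi>: "\<And>n. n \<notin> set ms \<Longrightarrow> \<xi> $ n = upd x m t $ n"
      "\<And>n. n \<in> set ms \<Longrightarrow> a $ n \<le> \<xi> $ n \<and> \<xi> $ n \<le> b $ n"
      "partial_square (set ms) F' a b (upd x m t) = (\<Prod>n\<in>set ms. b $ n - a $ n) * G \<xi>"
    using snoc.IH[OF F'(2) dist, of "upd x m t"] by blast
  have "partial_square (set (ms @ [m])) F a b x = (\<Prod>n\<in>set (ms @ [m]). b $ n - a $ n) * G \<xi>"
    unfolding t(3) \<xi>(3) using m by simp
  moreover have "\<xi> $ m = t" using \<xi>(1)[OF m] by simp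
  ultimately show ?case
    using \<xi>(1,2) t(1,2) by (intro exI[of _ \<xi>]) auto
qed

lemma square_mvt:
  fixes F G :: "(real, 'n::{finite,linorder}) vec \<Rightarrow> real"
  assumes "has_mixed_partial (sorted_list_of_set UNIV) F G" "\<And>n. a $ n \<le> b $ n"
  obtains \<xi> where "\<xi> \<in> cbox a b" "square F a b = measure lborel (cbox a b) * G \<xi>"
proof -
  obtain \<xi> where "\<forall>n. a $ n \<le> \<xi> $ n \<and> \<xi> $ n \<le> b $ n"
      "partial_square UNIV F a b 0 = (\<Prod>n\<in>UNIV. b $ n - a $ n) * G \<xi>"
    using partial_square_mvt[OF assms(1) _ assms(2), of 0] by auto
  moreover have "measure lborel (cbox a b) = (\<Prod>n\<in>UNIV. b $ n - a $ n)"
    using assms(2) by (intro content_cbox_cart) (auto simp: cbox_interval less_eq_vec_def)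
  ultimately show ?thesis
    using that[of \<xi>] by (simp add: square_eq_partial_square[of F a b 0] mem_box_cart)
qed

section \<open>The mixed difference as an additive function of boxes\<close>

definition box_square :: "(real^'n \<Rightarrow> real) \<Rightarrow> (real^'n) set \<Rightarrow> real" where
  "box_square F K = (if measure lborel K = 0 then 0 else square F (interval_lowerbound K) (interval_upperbound K))"

lemma measure_cbox_cart_nonzero_iff:
  fixes a b :: "real^'n"
  shows "measure lborel (cbox a b) \<noteq> 0 \<longleftrightarrow> (\<forall>n. a $ n < b $ n)"
proof -
  have "measure lborel (cbox a b) \<noteq> 0 \<longleftrightarrow> (\<forall>i\<in>Basis. a \<bullet> i < b \<bullet> i)"
    by (simp only: content_eq_0) (meson not_le)
  also have "\<dots> \<longleftrightarrow> (\<forall>n. a $ n < b $ n)"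
    by (auto simp: Basis_vec_def inner_axis)
  finally show ?thesis .
qed

lemma box_square_cbox:
  fixes a b :: "real^'n"
  assumes "\<And>n. a $ n \<le> b $ n"
  shows "box_square F (cbox a b) = square F a b"
proof (cases "\<forall>n. a $ n < b $ n")
  case True
  then have "\<forall>i\<in>Basis. a \<bullet> i \<le> b \<bullet> i"
    by (auto simp: Basis_vec_def inner_axis less_imp_le)
  then show ?thesis
    using True measure_cbox_cart_nonzero_iff[of a b] by (simp add: box_square_def)
next
  case False
  then obtain k where "a $ k = b $ k"
    using assms by (metis order.not_eq_order_implies_strict)
  then show ?thesis
    using False square_degenerate[of a k b F] measure_cbox_cart_nonzero_iff[of a b] by (simp add: box_square_def)
qed

text \<open>A cut inside the box is \<open>square_additive\<close>; a cut outside its interior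
  leaves the box itself and a box of measure 0. Setting \<open>box_square\<close> to 0 on boxes of
  measure 0 covers the empty box, which does not determine its corners, and agrees with
  \<open>square\<close> on degenerate boxes.\<close>

lemma operative_box_square:
  fixes F :: "real^'n \<Rightarrow> real"
  shows "operative plus 0 (box_square F)"
proof (unfold_locales, goal_cases)
  case (1 a b)
  then show ?case by (simp add: box_square_def content_eq_0_interior)
next
  case (2 a b c k)
  then obtain j where k: "k = axis j 1" by (auto simp: Basis_vec_def)
  have k_nth: "x \<bullet> k = x $ j" for x :: "real^'n"
    by (simp add: k inner_axis)
  have halves: "cbox a b \<inter> {x. x \<bullet> k \<le> c} = cbox a (upd b j (min (b $ j) c))"
    "cbox a b \<inter> {x. c \<le> x \<bullet> k} = cbox (upd a j (max (a $ j) c)) b"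
    unfolding k_nth by (auto simp: mem_box_cart split: if_splits)
  show ?case
  proof (cases "\<forall>n. a $ n < b $ n")
    case False
    then obtain n where "b $ n \<le> a $ n" by (auto simp: not_less)
    then have "\<not> (\<forall>n. a $ n < upd b j (min (b $ j) c) $ n)"
      "\<not> (\<forall>n. upd a j (max (a $ j) c) $ n < b $ n)" "\<not> (\<forall>n. a $ n < b $ n)"
      by (auto simp: not_less max_def intro!: exI[of _ n])
    then have "measure lborel (cbox a (upd b j (min (b $ j) c))) = 0"
      "measure lborel (cbox (upd a j (max (a $ j) c)) b) = 0" "measure lborel (cbox a b) = 0"
      using measure_cbox_cart_nonzero_iff by blast+
    then show ?thesis
      unfolding halves by (simp add: box_square_def)
  next
    case True
    consider "c \<le> a $ j" | "b $ j \<le> c" | "a $ j < c" "c < b $ j" by linarith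
    then show ?thesis
    proof cases
      case 1
      then have "\<not> (\<forall>n. a $ n < upd b j (min (b $ j) c) $ n)"
        by (auto simp: not_less intro!: exI[of _ j])
      then have "measure lborel (cbox a (upd b j (min (b $ j) c))) = 0"
        using measure_cbox_cart_nonzero_iff by blast
      moreover have "upd a j (max (a $ j) c) = a" using 1 by (auto simp: vec_eq_iff)
      ultimately show ?thesis
        unfolding halves by (simp add: box_square_def)
    next
      case 2
      then have "\<not> (\<forall>n. upd a j (max (a $ j) c) $ n < b $ n)"
        by (auto simp: not_less intro!: exI[of _ j])
      then have "measure lborel (cbox (upd a j (max (a $ j) c)) b) = 0"
        using measure_cbox_cart_nonzero_iff by blast
      moreover have "upd b j (min (b $ j) c) = b" using 2 by (auto simp: vec_eq_iff)
      ultimately show ?thesis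
        unfolding halves by (simp add: box_square_def)
    next
      case 3
      then have "min (b $ j) c = c" "max (a $ j) c = c" by auto
      with 3 True show ?thesis
        unfolding halves by (subst (1 2 3) box_square_cbox) (auto simp: less_imp_le intro: square_additive)
    qed
  qed
qed

text \<open>Riemann sums of \<open>G\<close> are compared with the additive box function of \<open>F\<close> by the mean value
  theorem on each small box, so only the outermost derivative has to be continuous.\<close>

lemma has_integral_square:
  fixes F G :: "(real, 'n::{finite,linorder}) vec \<Rightarrow> real"
  assumes mixed: "has_mixed_partial (sorted_list_of_set UNIV) F G"
    and cont: "continuous_on UNIV G" and ab: "\<And>n. a $ n \<le> b $ n"
  shows "(G has_integral square F a b) (cbox a b)"
  unfolding has_integral
proof (intro allI impI)
  fix e :: real assume "e > 0"
  interpret operative plus 0 "box_square F" by (rule operative_box_square)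
  \<comment> \<open>The summand 1 keeps the denominator positive when the box is degenerate, and
    makes the final estimate strict.\<close>
  define e' where "e' = e / (measure lborel (cbox a b) + 1)"
  have "e' > 0" using \<open>e > 0\<close> by (simp add: e'_def add_nonneg_pos)
  have "uniformly_continuous_on (cbox a b) G"
    using cont by (intro compact_uniformly_continuous) (auto intro: continuous_on_subset)
  then obtain d where d: "d > 0" "\<And>x y. x \<in> cbox a b \<Longrightarrow> y \<in> cbox a b \<Longrightarrow> dist y x < d \<Longrightarrow> dist (G y) (G x) < e'"
    unfolding uniformly_continuous_on_def using \<open>e' > 0\<close> by metis
  show "\<exists>g. gauge g \<and> (\<forall>D. D tagged_division_of cbox a b \<and> g fine D \<longrightarrow>
      norm ((\<Sum>(x, k)\<in>D. measure lborel k *\<^sub>R G x) - square F a b) < e)"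
  proof (intro exI conjI allI impI)
    show "gauge (\<lambda>x. ball x d)" using d(1) by auto
    fix D assume D: "D tagged_division_of cbox a b \<and> (\<lambda>x. ball x d) fine D"
    \<comment> \<open>Additivity distributes the mixed difference over the pieces of the division,
      so that it can be compared with the Riemann sum piece by piece.\<close>
    have "(\<Sum>(x, K)\<in>D. box_square F K) = square F a b"
      using tagged_division[of D a b] D ab by (simp add: box_square_cbox sum_def)
    then have "norm ((\<Sum>(x, k)\<in>D. measure lborel k *\<^sub>R G x) - square F a b) =
        norm (\<Sum>(x, K)\<in>D. measure lborel K * G x - box_square F K)"
      by (simp add: sum_subtractf split_beta)
    also have "\<dots> \<le> (\<Sum>(x, K)\<in>D. measure lborel K * e')"
      unfolding split_beta
    proof (rule sum_norm_le)
      fix p assume p: "p \<in> D"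
      obtain x K where xK: "p = (x, K)" by (cases p)
      from p D xK have K: "x \<in> K" "K \<subseteq> cbox a b" "\<exists>u v. K = cbox u v" "K \<subseteq> ball x d"
        by (auto simp: fine_def dest: tagged_division_ofD)
      then obtain u v where uv: "K = cbox u v" by blast
      have "u $ n \<le> v $ n" for n
        using \<open>x \<in> K\<close> unfolding uv mem_box_cart by (meson order_trans)
      then obtain \<xi> where \<xi>: "\<xi> \<in> K" "box_square F K = measure lborel K * G \<xi>"
        using square_mvt[OF mixed, of u v] unfolding uv by (metis box_square_cbox)
      have "dist (G \<xi>) (G x) < e'"
        using K \<xi>(1) by (intro d(2)) (auto simp: dist_commute)
      then have "measure lborel K * \<bar>G x - G \<xi>\<bar> \<le> measure lborel K * e'"
        by (intro mult_left_mono) (auto simp: dist_real_def)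
      then show "norm (measure lborel (snd p) * G (fst p) - box_square F (snd p)) \<le> measure lborel (snd p) * e'"
        by (simp add: xK \<xi>(2) abs_mult flip: right_diff_distrib)
    qed
    also have "\<dots> = measure lborel (cbox a b) * e'"
      using D additive_content_tagged_division[of D a b]
      by (simp add: split_beta flip: sum_distrib_right)
    also have "\<dots> < (measure lborel (cbox a b) + 1) * e'"
      using \<open>e' > 0\<close> by simp
    also have "\<dots> = e"
      by (simp add: e'_def add_nonneg_pos less_imp_neq[THEN not_sym])
    finally show "norm ((\<Sum>(x, k)\<in>D. measure lborel k *\<^sub>R G x) - square F a b) < e" .
  qed
qed

section \<open>Half-open boxes and measures\<close>

text \<open>Links countable additivity over \<open>I\<close>, which produces an integral against
  counting measure, with the unordered real sum in \<open>Mop\<close>. Finiteness of the integral is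
  what gives summability.\<close>

lemma nn_integral_count_space_eq_iff_has_sum:
  fixes f :: "'i \<Rightarrow> real"
  assumes f: "\<And>i. i \<in> I \<Longrightarrow> 0 \<le> f i" and s: "0 \<le> s"
  shows "(\<integral>\<^sup>+i. ennreal (f i) \<partial>count_space I) = ennreal s \<longleftrightarrow> (f has_sum s) I"
proof
  assume sum: "(\<integral>\<^sup>+i. ennreal (f i) \<partial>count_space I) = ennreal s"
  then have "integrable (count_space I) f"
    by (intro integrableI_nonneg) (auto simp: AE_count_space f)
  then have abs: "Infinite_Set_Sum.abs_summable_on f I"
    by (simp add: Infinite_Set_Sum.abs_summable_on_def)
  then have "ennreal s = ennreal (infsetsum f I)"
    using sum nn_integral_conv_infsetsum[of f I] f by simp
  then have "infsum f I = s"
    using s infsetsum_nonneg[of I f] f infsetsum_infsum[OF abs] by simp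
  moreover have "f summable_on I"
    using abs abs_summable_equivalent[of f I] by (auto intro: abs_summable_summable)
  ultimately show "(f has_sum s) I" by (simp add: has_sum_iff)
next
  assume sum: "(f has_sum s) I"
  then have "f summable_on I" by (simp add: has_sum_iff)
  then have "(\<lambda>i. norm (f i)) summable_on I"
    by (rule summable_on_cong[THEN iffD1, rotated]) (simp add: f)
  then have "Infinite_Set_Sum.abs_summable_on f I"
    using abs_summable_equivalent[of f I] by simp
  then show "(\<integral>\<^sup>+i. ennreal (f i) \<partial>count_space I) = ennreal s"
    using nn_integral_conv_infsetsum[of f I] f infsetsum_infsum[of f I] sum by (simp add: has_sum_iff)
qed

section \<open>Half-open boxes and integrals over them\<close>

abbreviation below :: "real^'n \<Rightarrow> (real^'n) set" where
  "below x \<equiv> {z. \<forall>n. z $ n < x $ n}"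

lemma open_below: "open (below (x :: real^'n))"
  unfolding Collect_all_eq by (intro open_INT) (auto simp: open_halfspace_component_lt_cart)

lemma borel_eq_below: "(borel :: (real^'n) measure) = sigma UNIV (range below)"
proof -
  have "eucl_less z a \<longleftrightarrow> (\<forall>n. z $ n < a $ n)" for z a :: "real^'n"
    by (auto simp: eucl_less_def Basis_vec_def inner_axis)
  then show ?thesis by (subst borel_eq_lessThan) simp
qed

lemma mem_Qbox:
  assumes "\<And>n. a $ n \<le> b $ n"
  shows "z \<in> Qbox a b \<longleftrightarrow> (\<forall>n. a $ n \<le> z $ n \<and> z $ n < b $ n)"
  using assms by (fastforce simp: Qbox_def closed_segment_eq_real_ivl less_le)

text \<open>In coordinate \<open>k\<close> the segment is a single point, and that point is
  removed.\<close>

lemma Qbox_degenerate: "a $ k = b $ k \<Longrightarrow> Qbox a b = {}"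
  by (auto simp: Qbox_def) (metis empty_iff insert_iff segment(1) Diff_iff closed_segment_idem)

lemma Qbox_borel:
  fixes a b :: "real^'n"
  assumes "\<And>n. a $ n \<le> b $ n"
  shows "Qbox a b \<in> sets borel"
proof -
  have "Qbox a b = (\<Inter>n. {z. a $ n \<le> z $ n} \<inter> {z. z $ n < b $ n})"
    using mem_Qbox[OF assms] by auto
  moreover have "{z :: real^'n. a $ n \<le> z $ n} \<in> sets borel" for n
    by (intro borel_closed closed_Collect_le continuous_intros)
  moreover have "{z :: real^'n. z $ n < b $ n} \<in> sets borel" for n
    by (intro borel_open open_Collect_less continuous_intros)
  ultimately show ?thesis by (auto intro!: sets.finite_INT)
qed

lemma Qbox_subset_cbox:
  assumes "\<And>n. a $ n \<le> b $ n"
  shows "Qbox a b \<subseteq> cbox a b"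
  by (auto simp: mem_Qbox[OF assms] mem_box_cart less_imp_le)

lemma box_subset_Qbox:
  assumes "\<And>n. a $ n \<le> b $ n"
  shows "box a b \<subseteq> Qbox a b"
  by (auto simp: mem_Qbox[OF assms] mem_box_cart less_imp_le)

lemma measure_Qbox_pos:
  fixes a b :: "real^'n"
  assumes "\<And>n. a $ n < b $ n"
  shows "0 < measure lborel (Qbox a b)"
proof -
  have le: "\<And>n. a $ n \<le> b $ n" using assms by (simp add: less_imp_le)
  have "measure lborel (box a b) > 0"
    using assms by (subst measure_lborel_box_eq) (auto simp: Basis_vec_def inner_axis less_imp_le intro!: prod_pos)
  also have "measure lborel (box a b) \<le> measure lborel (Qbox a b)"
    using box_subset_Qbox[OF le] Qbox_subset_cbox[OF le] Qbox_borel[OF le]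
    by (intro measure_mono_fmeasurable)
      (auto intro: fmeasurableI2[of "cbox a b"])
  finally show ?thesis .
qed

lemma set_integrable_Qbox:
  fixes h :: "real^'n \<Rightarrow> real"
  assumes h: "continuous_on UNIV h" and le: "\<And>n. a $ n \<le> b $ n"
    and E: "E \<in> sets borel" "E \<subseteq> Qbox a b"
  shows "set_integrable lborel E h"
proof -
  have "set_integrable lborel (cbox a b) h"
    unfolding set_integrable_def
    by (rule borel_integrable_compact) (auto intro: continuous_on_subset[OF h])
  then show ?thesis
    by (rule set_integrable_subset) (use E Qbox_subset_cbox[OF le] in auto)
qed

text \<open>The half-open box differs from the closed one only within the frontier, which is
  negligible.\<close>

lemma set_integral_Qbox_eq_square:
  fixes F G :: "(real, 'n::{finite,linorder}) vec \<Rightarrow> real"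
  assumes mixed: "has_mixed_partial (sorted_list_of_set UNIV) F G"
    and cont: "continuous_on UNIV G" and le: "\<And>n. a $ n \<le> b $ n"
  shows "(LINT z:Qbox a b|lborel. G z) = square F a b"
proof -
  have "(LINT z:Qbox a b|lborel. G z) = integral (Qbox a b) G"
    by (rule set_borel_integral_eq_integral) (rule set_integrable_Qbox[OF cont le Qbox_borel[OF le] order_refl])
  also have "\<dots> = integral (cbox a b) G"
  proof (rule integral_spike_set)
    show "negligible {x \<in> Qbox a b - cbox a b. G x \<noteq> 0}"
      using Qbox_subset_cbox[OF le] by (auto intro: negligible_subset[of "{}"])
    show "negligible {x \<in> cbox a b - Qbox a b. G x \<noteq> 0}"
      using box_subset_Qbox[OF le] by (intro negligible_subset[OF negligible_frontier_interval[of a b]]) auto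
  qed
  also have "\<dots> = square F a b"
    by (rule integral_unique) (rule has_integral_square[OF mixed cont le])
  finally show ?thesis .
qed

text \<open>Dynkin's argument for a real-valued set function, to be applied to differences of two
  set functions that are finite on the box. The orthants \<open>below a\<close> form an
  intersection-stable generator of the Borel sets, and each of them meets \<open>Qbox 0 x\<close> in
  the empty set or in some \<open>Qbox 0 y\<close> with \<open>y\<close> positive and at most
  \<open>x\<close>.\<close>

lemma additive_zero_on_boxes:
  fixes \<phi> :: "(real^'n) set \<Rightarrow> real" and x :: "real^'n"
  assumes add: "\<And>A :: nat \<Rightarrow> (real^'n) set. disjoint_family A \<Longrightarrow> (\<And>i. A i \<in> sets borel) \<Longrightarrow>
      (\<And>i. A i \<subseteq> Qbox 0 x) \<Longrightarrow> (\<lambda>i. \<phi> (A i)) sums \<phi> (\<Union>i. A i)"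
    and zero: "\<And>y. (\<And>n. 0 < y $ n \<and> y $ n \<le> x $ n) \<Longrightarrow> \<phi> (Qbox 0 y) = 0"
    and x: "\<And>n. 0 < x $ n"
    and E: "E \<in> sets borel" "E \<subseteq> Qbox 0 x"
  shows "\<phi> E = 0"
proof -
  let ?Q = "Qbox 0 x"
  have Q: "?Q \<in> sets borel"
    using x by (intro Qbox_borel) (simp add: less_imp_le)
  have "(\<lambda>i. \<phi> {}) sums \<phi> (\<Union>i::nat. {})"
    by (rule add) (auto simp: disjoint_family_on_def)
  then have empty: "\<phi> {} = 0"
    by (auto dest!: sums_summable simp: summable_const_iff)
  have add2: "\<phi> (A \<union> B) = \<phi> A + \<phi> B"
    if "A \<inter> B = {}" "A \<in> sets borel" "B \<in> sets borel" "A \<subseteq> ?Q" "B \<subseteq> ?Q" for A B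
  proof -
    have "(\<lambda>i. \<phi> (binaryset A B i)) sums \<phi> (\<Union>i. binaryset A B i)"
      using that by (intro add) (auto simp: binaryset_def disjoint_family_on_def)
    moreover have "(\<lambda>i. \<phi> (binaryset A B i)) sums (\<phi> A + \<phi> B)"
      by (rule binaryset_sums) (rule empty)
    ultimately show ?thesis
      by (simp add: UN_binaryset_eq sums_unique2)
  qed
  let ?G = "range (below :: real^'n \<Rightarrow> _)"
  have Int: "Int_stable ?G"
  proof (rule Int_stableI)
    fix A B assume "A \<in> ?G" "B \<in> ?G"
    then obtain a b :: "real^'n" where "A = below a" "B = below b" by auto
    then have "A \<inter> B = below (\<chi> n. min (a $ n) (b $ n))"
      by auto
    then show "A \<inter> B \<in> ?G" by blast
  qed
  have "E \<in> sigma_sets UNIV ?G"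
    using E(1) by (subst (asm) borel_eq_below) simp
  then have "\<phi> (E \<inter> ?Q) = 0"
  proof (induction rule: sigma_sets_induct_disjoint[OF Int, of UNIV, OF Pow_UNIV[THEN equalityD2, THEN subset_trans[OF subset_UNIV]], consumes 1, case_names basic empty compl union])
    case (basic A)
    then obtain a :: "real^'n" where A: "A = below a" by auto
    show ?case
    proof (cases "\<forall>n. 0 < a $ n")
      case True
      define y where "y = (\<chi> n. min (a $ n) (x $ n))"
      have y: "0 < y $ n \<and> y $ n \<le> x $ n" for n using True x by (simp add: y_def)
      then have "A \<inter> ?Q = Qbox 0 y"
        using x by (auto simp: mem_Qbox less_imp_le A y_def)
      then show ?thesis using zero[of y] y by simp
    next
      case False
      then obtain k where "a $ k \<le> 0" by (auto simp: not_less)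
      then have "A \<inter> ?Q = {}"
        using x by (auto simp: mem_Qbox less_imp_le A)
          (metis not_le order_trans)
      then show ?thesis by (simp add: empty)
    qed
  next
    case empty
    show ?case by (simp add: \<open>\<phi> {} = 0\<close>)
  next
    case (compl A)
    have [measurable]: "A \<in> sets borel" using compl(1) by (subst borel_eq_below) simp
    have "\<phi> ?Q = \<phi> (A \<inter> ?Q) + \<phi> ((UNIV - A) \<inter> ?Q)"
      using Q by (subst add2[symmetric]) (auto intro: arg_cong[where f = \<phi>])
    moreover have "\<phi> ?Q = 0" by (rule zero) (simp add: x)
    ultimately show ?case using compl(2) by simp
  next
    case (union A)
    have A: "A i \<in> sets borel" for i using union(2) by (subst borel_eq_below) auto
    have "(\<lambda>i. \<phi> (A i \<inter> ?Q)) sums \<phi> (\<Union>i. A i \<inter> ?Q)"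
      using union(1) A Q by (intro add) (auto simp: disjoint_family_on_def)
    then have "(\<lambda>i. 0) sums \<phi> (\<Union>i. A i \<inter> ?Q)" using union(3) by simp
    moreover have "(\<Union>i. A i \<inter> ?Q) = (\<Union>i. A i) \<inter> ?Q" by auto
    ultimately show ?case using sums_unique2[OF _ sums_zero] by metis
  qed
  then show ?thesis using E(2) by (simp add: Int_absorb2)
qed

text \<open>Making the cover disjoint cuts \<open>E\<close> into countably many pieces, each inside
  one member of the cover. This carries agreement within single boxes over to their union.\<close>

lemma emeasure_eq_on_countable_cover:
  assumes sets: "sets M = sets N" and C: "countable C" "\<And>c. c \<in> C \<Longrightarrow> B c \<in> sets M"
    and eq: "\<And>c A. c \<in> C \<Longrightarrow> A \<in> sets M \<Longrightarrow> A \<subseteq> B c \<Longrightarrow> emeasure M A = emeasure N A"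
    and E: "E \<in> sets M" "E \<subseteq> (\<Union>c\<in>C. B c)"
  shows "emeasure M E = emeasure N E"
proof (cases "C = {}")
  case True
  then show ?thesis using E by simp
next
  case False
  define D where "D = (\<lambda>n::nat. E \<inter> disjointed (\<lambda>n. B (from_nat_into C n)) n)"
  have BM: "B (from_nat_into C n) \<in> sets M" for n using C False by (simp add: from_nat_into)
  then have "range (disjointed (\<lambda>n. B (from_nat_into C n))) \<subseteq> sets M"
    by (intro sets.range_disjointed_sets) auto
  then have D: "D n \<in> sets M" for n using E(1) by (auto simp: D_def)
  have disj: "disjoint_family D"
    using disjoint_family_disjointed[of "\<lambda>n. B (from_nat_into C n)"]
    by (auto simp: D_def disjoint_family_on_def)
  have "(\<Union>n. D n) = E \<inter> (\<Union>n. B (from_nat_into C n))"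
    unfolding D_def by (metis Int_UN_distrib UN_disjointed_eq)
  also have "(\<Union>n. B (from_nat_into C n)) = (\<Union>c\<in>C. B c)"
    using range_from_nat_into[OF False C(1)] by (metis image_image)
  finally have U: "(\<Union>n. D n) = E" using E(2) by auto
  have "D n \<subseteq> B (from_nat_into C n)" for n
    using disjointed_subset[of "\<lambda>n. B (from_nat_into C n)" n] by (auto simp: D_def)
  then have "emeasure M (D n) = emeasure N (D n)" for n
    using False D by (intro eq[of "from_nat_into C n"]) (auto simp: from_nat_into)
  then show ?thesis
    using suminf_emeasure[of D M] suminf_emeasure[of D N] D disj sets U
    by (metis (no_types, lifting) image_subsetI suminf_cong)
qed

lemma set_integral_sums:
  fixes f :: "'a \<Rightarrow> real"
  assumes A: "\<And>i::nat. A i \<in> sets M" and disj: "disjoint_family A"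
    and f: "set_integrable M (\<Union>i. A i) f"
  shows "(\<lambda>i. LINT x:A i|M. f x) sums (LINT x:(\<Union>i. A i)|M. f x)"
  unfolding sums_def
proof -
  have int: "set_integrable M (A i) f" for i
    using f by (rule set_integrable_subset) (use A in auto)
  have "(\<Sum>i<n. LINT x:A i|M. f x) = (LINT x:(\<Union>i<n. A i)|M. f x)" for n
    using A disj int
    by (subst set_integral_finite_Union) (auto simp: disjoint_family_on_def)
  moreover have "(\<lambda>n. LINT x:(\<Union>i<n. A i)|M. f x) \<longlonglongrightarrow> (LINT x:(\<Union>n. \<Union>i<n. A i)|M. f x)"
  proof (rule set_integral_cont_up)
    show "(\<Union>i<n. A i) \<in> sets M" for n using A by auto
    show "incseq (\<lambda>n. \<Union>i<n. A i)" by (auto simp: incseq_def intro: order.strict_trans2)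
    show "set_integrable M (\<Union>n. \<Union>i<n. A i) f" using f by (simp add: UN_UN_finite_eq lessThan_atLeast0)
  qed
  ultimately show "(\<lambda>n. \<Sum>i<n. LINT x:A i|M. f x) \<longlonglongrightarrow> (LINT x:(\<Union>i. A i)|M. f x)"
    by (simp add: UN_UN_finite_eq lessThan_atLeast0)
qed

text \<open>Intended for a distribution function and \<open>x = 0\<close>: every corner other than
  \<open>y\<close> then has a zero coordinate.\<close>

lemma square_eq_at_upper_corner:
  fixes x y :: "real^'n"
  assumes "\<And>M. M \<noteq> {} \<Longrightarrow> f (pi_pt M x y) = 0"
  shows "square f x y = f y"
proof -
  have "square f x y = (\<Sum>M\<in>{{}}. (- 1) ^ card M * f (pi_pt M x y))"
    unfolding square_def by (rule sum.mono_neutral_right) (auto simp: assms)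
  then show ?thesis by (simp add: pi_pt_def)
qed

section \<open>Down-closed compact sets\<close>

locale down_closed =
  fixes T :: "(real^'n) set"
  assumes compact_T: "compact T"
    and T_nonneg: "\<And>x n. x \<in> T \<Longrightarrow> 0 \<le> x $ n"
    and Qbox_subset_T: "\<And>x. x \<in> T \<Longrightarrow> Qbox 0 x \<subseteq> T"
begin

text \<open>The part of \<open>T\<close> that the distribution function can see;
  \<open>T - U\<close> is the set in \<open>no_outer_mass\<close>.\<close>

definition U :: "(real^'n) set" where "U = (\<Union>x\<in>T. Qbox 0 x)"

lemma T_borel: "T \<in> sets borel"
  using compact_T by (simp add: borel_compact)

lemma emeasure_T_finite: "emeasure lborel T < \<infinity>"
  using compact_T emeasure_compact_finite by blast

lemma mem_Qbox_T: "x \<in> T \<Longrightarrow> z \<in> Qbox 0 x \<longleftrightarrow> (\<forall>n. 0 \<le> z $ n \<and> z $ n < x $ n)"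
  using mem_Qbox[of 0 x z] T_nonneg by simp

lemma Qbox_T_borel: "x \<in> T \<Longrightarrow> Qbox 0 x \<in> sets borel"
  using T_nonneg by (intro Qbox_borel) simp

lemma U_subset_T: "U \<subseteq> T"
  using Qbox_subset_T by (auto simp: U_def)

text \<open>Shrinking \<open>z\<close> towards 0 moves it into the half-open box below
  \<open>x\<close>, and closedness of \<open>T\<close> returns it in the limit. Positivity of
  \<open>x\<close> keeps the coordinates where \<open>z\<close> is 0 strictly below
  \<open>x\<close>.\<close>

lemma closed_box_subset_T:
  assumes "x \<in> T" "\<And>n. 0 < x $ n" "\<And>n. 0 \<le> z $ n" "\<And>n. z $ n \<le> x $ n"
  shows "z \<in> T"
proof (rule closed_sequentially)
  show "closed T" using compact_T by (rule compact_imp_closed)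
  let ?f = "\<lambda>k. (1 - 1 / real (Suc k)) *\<^sub>R z"
  have "(1 - 1 / real (Suc k)) * z $ n < x $ n" for k n
  proof (cases "z $ n = 0")
    case True
    then show ?thesis using assms(2) by simp
  next
    case False
    then have "(1 - 1 / real (Suc k)) * z $ n < 1 * z $ n"
      using assms(3)[of n] by (intro mult_strict_right_mono) auto
    then show ?thesis using assms(4)[of n] by simp
  qed
  then have "?f k \<in> Qbox 0 x" for k
    using assms(1,3) by (auto simp: mem_Qbox_T)
  then show "\<And>k. ?f k \<in> T" using Qbox_subset_T[OF assms(1)] by blast
  have "(\<lambda>k. (1 - 1 / real (Suc k)) *\<^sub>R z) \<longlonglongrightarrow> (1 - 0) *\<^sub>R z"
    by (intro tendsto_intros LIMSEQ_Suc[OF lim_1_over_n])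
  then show "?f \<longlonglongrightarrow> z" by simp
qed

text \<open>The half-open boxes are not open in general, so Lindelof's theorem is applied to the
  open orthants \<open>below x\<close>. For points with nonnegative coordinates, membership in the
  orthant and in the box is the same.\<close>

lemma countable_cover:
  obtains C where "countable C" "C \<subseteq> T" "U = (\<Union>x\<in>C. Qbox 0 x)"
proof -
  obtain F' where F': "F' \<subseteq> below ` T" "countable F'" "\<Union>F' = \<Union>(below ` T)"
    using Lindelof[of "below ` T"] open_below by blast
  then obtain C where C: "countable C" "C \<subseteq> T" "F' = below ` C"
    using countable_subset_image[of F' below T] by auto
  have "U \<subseteq> (\<Union>x\<in>C. Qbox 0 x)"
  proof
    fix z assume "z \<in> U"
    then obtain x where x: "x \<in> T" "\<forall>n. 0 \<le> z $ n \<and> z $ n < x $ n"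
      by (auto simp: U_def mem_Qbox_T)
    then have "z \<in> \<Union>(below ` T)" by auto
    then have "z \<in> \<Union>(below ` C)" using F'(3) C(3) by simp
    then obtain y where "y \<in> C" "\<forall>n. z $ n < y $ n" by auto
    then show "z \<in> (\<Union>x\<in>C. Qbox 0 x)"
      using x C(2) by (auto simp: mem_Qbox_T intro!: bexI[of _ y])
  qed
  moreover have "(\<Union>x\<in>C. Qbox 0 x) \<subseteq> U" using C(2) by (auto simp: U_def)
  ultimately show ?thesis using that C by blast
qed

lemma U_borel: "U \<in> sets borel"
proof -
  obtain C where C: "countable C" "C \<subseteq> T" "U = (\<Union>x\<in>C. Qbox 0 x)" by (rule countable_cover)
  show ?thesis unfolding C(3)
    using C(1,2) Qbox_T_borel by (intro sets.countable_UN') auto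
qed

text \<open>Two points of \<open>T - U\<close> are never strictly ordered in all coordinates, so every ray from
  \<open>(-1, \<dots>, -1)\<close> meets \<open>T - U\<close> in at most one point.\<close>

lemma emeasure_T_minus_U: "emeasure lborel (T - U) = 0"
proof -
  have eq: "T - U = T - (\<Union>x\<in>T. below x)"
    using T_nonneg by (auto simp: U_def mem_Qbox_T)
  have closed: "closed (T - U)"
    unfolding eq using compact_T by (intro closed_Diff open_UN compact_imp_closed) (auto simp: open_below)
  have not_less: "\<not> (\<forall>n. z $ n < x $ n)" if "z \<in> T - U" "x \<in> T" for x z
    using that unfolding eq by auto
  have "negligible (T - U)"
  proof (rule starlike_negligible[OF closed, of "\<chi> n. -1"])
    fix c and x :: "real^'n"
    assume cx: "(\<chi> n. -1) + c *\<^sub>R x \<in> T - U" and x: "(\<chi> n. -1) + x \<in> T - U"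
    \<comment> \<open>The centre lies strictly below \<open>T\<close> in every coordinate, so all
      directions are strictly positive, and rescaling one moves every coordinate strictly the same
      way.\<close>
    have pos: "0 < x $ n" for n using T_nonneg[of "(\<chi> n. -1) + x" n] x by simp
    show "c = 1"
    proof (rule ccontr)
      assume "c \<noteq> 1"
      then consider "c < 1" | "1 < c" by linarith
      then show False
      proof cases
        case 1
        then have "c * x $ n < x $ n" for n using pos[of n] by simp
        then show False using not_less[OF cx, of "(\<chi> n. -1) + x"] x by simp
      next
        case 2
        then have "x $ n < c * x $ n" for n using pos[of n] by simp
        then show False using not_less[OF x, of "(\<chi> n. -1) + c *\<^sub>R x"] cx by simp
      qed
    qed
  qed
  then have "T - U \<in> null_sets lebesgue" by (simp add: negligible_iff_null_sets)
  then show ?thesis using U_borel T_borel by (auto simp: null_sets_def)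
qed

end

section \<open>Tilings by affine images\<close>

lemma Basis_cart: "(Basis :: (real^'n) set) = range (\<lambda>n. axis n 1)"
  by (auto simp: Basis_vec_def)

text \<open>The image is the preimage under the continuous inverse, hence Borel. The factor comes
  from the affine transformation formula for Lebesgue measure, once \<open>g\<close> is rewritten
  over \<open>Basis\<close>.\<close>

lemma emeasure_diagonal_affine_image:
  fixes c t :: "real^'n"
  assumes c: "\<And>n. 0 < c $ n" and g: "\<And>x. g x = (\<chi> n. c $ n * x $ n + t $ n)"
    and E: "E \<in> sets borel"
  shows "g ` E \<in> sets borel" "emeasure lborel (g ` E) = ennreal (\<Prod>n\<in>UNIV. c $ n) * emeasure lborel E"
proof -
  let ?d = "\<lambda>x :: real^'n. \<chi> n. (x $ n - t $ n) / c $ n"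
  have gd: "g (?d x) = x" and dg: "?d (g x) = x" for x
    using c by (simp_all add: g vec_eq_iff less_imp_neq[THEN not_sym])
  have "continuous_on UNIV ?d"
    using c by (intro continuous_intros) (auto simp: less_imp_neq[THEN not_sym])
  then have [measurable]: "?d \<in> borel_measurable borel" by (rule borel_measurable_continuous_onI)
  have cont: "continuous_on UNIV g"
    unfolding g by (intro continuous_intros)
  then have [measurable]: "g \<in> borel_measurable borel" by (rule borel_measurable_continuous_onI)
  have "g ` E = ?d -` E"
    using gd dg by (auto simp: image_iff) metis
  then show gE: "g ` E \<in> sets borel"
    using measurable_sets[of ?d borel borel E] E by simp
  have axis_inj: "inj (\<lambda>n :: 'n. axis n (1 :: real))"
    by (auto simp: inj_on_def axis_eq_axis)
  have aff: "g = (\<lambda>x. t + (\<Sum>j\<in>Basis. ((c \<bullet> j) * (x \<bullet> j)) *\<^sub>R j))"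
  proof
    fix x :: "real^'n"
    have "(\<Sum>j\<in>Basis. ((c \<bullet> j) * (x \<bullet> j)) *\<^sub>R j) = (\<Sum>n\<in>UNIV. (c $ n * x $ n) *\<^sub>R axis n 1)"
      unfolding Basis_cart using axis_inj by (simp add: sum.reindex inner_axis)
    also have "\<dots> = (\<chi> n. c $ n * x $ n)"
      by (simp add: vec_eq_iff axis_def if_distrib[of "\<lambda>u. _ * u"] sum.delta' cong: if_cong)
    finally show "g x = t + (\<Sum>j\<in>Basis. ((c \<bullet> j) * (x \<bullet> j)) *\<^sub>R j)"
      by (simp add: g vec_eq_iff)
  qed
  have prod: "(\<Prod>j\<in>Basis. \<bar>c \<bullet> j\<bar>) = (\<Prod>n\<in>UNIV. c $ n)"
    unfolding Basis_cart using axis_inj c by (simp add: prod.reindex inner_axis abs_of_pos)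
  have "c \<bullet> j \<noteq> 0" if "j \<in> Basis" for j
    using that c by (auto simp: Basis_cart inner_axis less_imp_neq[THEN not_sym])
  from lborel_affine_euclidean[of "\<lambda>j. c \<bullet> j" t, OF this]
  have "lborel = density (distr lborel borel g) (\<lambda>_. ennreal (\<Prod>n\<in>UNIV. c $ n))"
    unfolding prod aff by simp
  then have "emeasure lborel (g ` E) = emeasure (density (distr lborel borel g) (\<lambda>_. ennreal (\<Prod>n\<in>UNIV. c $ n))) (g ` E)"
    by simp
  also have "\<dots> = ennreal (\<Prod>n\<in>UNIV. c $ n) * emeasure (distr lborel borel g) (g ` E)"
    using gE by (simp add: emeasure_density nn_integral_cmult)
  also have "emeasure (distr lborel borel g) (g ` E) = emeasure lborel (g -` g ` E)"
    using gE by (simp add: emeasure_distr)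
  also have "g -` g ` E = E"
    using dg by (auto simp: image_iff) metis
  finally show "emeasure lborel (g ` E) = ennreal (\<Prod>n\<in>UNIV. c $ n) * emeasure lborel E" .
qed

locale tiling = down_closed T for T :: "(real^'n) set" +
  fixes I :: "'i set" and \<gamma> :: "'i \<Rightarrow> real^'n \<Rightarrow> real^'n" and \<alpha> a :: "'i \<Rightarrow> real^'n"
  assumes countable_I: "countable I" and I_nonempty: "I \<noteq> {}"
    and \<alpha>: "\<And>i n. i \<in> I \<Longrightarrow> 0 < \<alpha> i $ n \<and> \<alpha> i $ n < 1"
    and \<gamma>: "\<And>i x. i \<in> I \<Longrightarrow> \<gamma> i x = (\<chi> n. \<alpha> i $ n * x $ n + a i $ n)"
    and admissible: "admissible I \<gamma> T"
    and T_pos: "emeasure lborel T > 0"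
    and overlap: "\<And>i j. i \<in> I \<Longrightarrow> j \<in> I \<Longrightarrow> i \<noteq> j \<Longrightarrow> emeasure lborel (\<gamma> i ` T \<inter> \<gamma> j ` T) = 0"
    and cover: "emeasure lborel (sym_diff T (\<Union>i\<in>I. \<gamma> i ` T)) = 0"
begin

definition A :: "(real^'n) set" where "A = Aset I \<gamma> T"

text \<open>The factor by which \<open>\<gamma> i\<close> scales Lebesgue measure.\<close>

definition p :: "'i \<Rightarrow> real" where "p i = (\<Prod>n\<in>UNIV. \<alpha> i $ n)"

lemma p_pos: "i \<in> I \<Longrightarrow> 0 < p i"
  using \<alpha> by (auto simp: p_def intro: prod_pos)

lemma \<gamma>_borel: "i \<in> I \<Longrightarrow> E \<in> sets borel \<Longrightarrow> \<gamma> i ` E \<in> sets borel"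
  using emeasure_diagonal_affine_image(1)[of "\<alpha> i" "\<gamma> i" "a i" E] \<alpha> \<gamma> by blast

lemma emeasure_\<gamma>: "i \<in> I \<Longrightarrow> E \<in> sets borel \<Longrightarrow> emeasure lborel (\<gamma> i ` E) = ennreal (p i) * emeasure lborel E"
  unfolding p_def using emeasure_diagonal_affine_image(2)[of "\<alpha> i" "\<gamma> i" "a i" E] \<alpha> \<gamma> by blast

lemma inj_\<gamma>: "i \<in> I \<Longrightarrow> inj (\<gamma> i)"
proof (rule injI)
  fix x y assume "i \<in> I" "\<gamma> i x = \<gamma> i y"
  moreover from this have "\<alpha> i $ n \<noteq> 0" for n using \<alpha>[of i n] by simp
  ultimately show "x = y" by (simp add: \<gamma> vec_eq_iff)
qed

lemma surj_\<gamma>: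
  assumes "i \<in> I"
  shows "surj (\<gamma> i)"
proof -
  have "\<alpha> i $ n \<noteq> 0" for n using \<alpha>[OF assms, of n] by simp
  then have "\<gamma> i (\<chi> n. (y $ n - a i $ n) / \<alpha> i $ n) = y" for y
    by (simp add: \<gamma>[OF assms] vec_eq_iff)
  then show ?thesis by (rule surjI)
qed

lemma continuous_\<gamma>: "i \<in> I \<Longrightarrow> continuous_on S (\<gamma> i)"
  by (subst continuous_on_cong[OF refl \<gamma>]) (auto intro!: continuous_intros)

lemma \<gamma>_corners: "i \<in> I \<Longrightarrow> x \<in> T \<Longrightarrow> corners (\<gamma> i 0) (\<gamma> i x) \<subseteq> T"
  using admissible by (auto simp: admissible_def)

lemma \<gamma>_T: "i \<in> I \<Longrightarrow> x \<in> T \<Longrightarrow> \<gamma> i x \<in> T"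
  using \<gamma>_corners[of i x] by (auto simp: corners_def)

lemma zero_in_T: "0 \<in> T"
  using admissible by (simp add: admissible_def)

text \<open>The vector \<open>a i\<close> is \<open>\<gamma> i 0\<close>, a point of
  \<open>T\<close>.\<close>

lemma a_nonneg: "i \<in> I \<Longrightarrow> 0 \<le> a i $ n"
  using T_nonneg[OF \<gamma>_T[OF _ zero_in_T], of i n] by (simp add: \<gamma>)

lemma \<gamma>_mono: "i \<in> I \<Longrightarrow> \<gamma> i x $ n \<le> \<gamma> i y $ n \<longleftrightarrow> x $ n \<le> y $ n"
  using \<alpha>[of i n] by (simp add: \<gamma>)

lemma \<gamma>_strict_mono: "i \<in> I \<Longrightarrow> \<gamma> i x $ n < \<gamma> i y $ n \<longleftrightarrow> x $ n < y $ n"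
  using \<gamma>_mono[of i y n x] by (simp flip: not_le)

lemma \<gamma>_Qbox:
  assumes i: "i \<in> I" and le: "\<And>n. x $ n \<le> y $ n"
  shows "\<gamma> i ` Qbox x y = Qbox (\<gamma> i x) (\<gamma> i y)"
proof -
  have "z \<in> Qbox x y \<longleftrightarrow> \<gamma> i z \<in> Qbox (\<gamma> i x) (\<gamma> i y)" for z
    using i le by (simp add: mem_Qbox \<gamma>_mono \<gamma>_strict_mono)
  then show ?thesis using surj_\<gamma>[OF i] by (auto simp: image_iff) (metis surjD)
qed

lemma \<gamma>_U:
  assumes "i \<in> I" "z \<in> U"
  shows "\<gamma> i z \<in> U"
proof -
  from assms(2) obtain x where x: "x \<in> T" "\<forall>n. 0 \<le> z $ n \<and> z $ n < x $ n"
    by (auto simp: U_def mem_Qbox_T)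
  have "0 \<le> \<gamma> i z $ n \<and> \<gamma> i z $ n < \<gamma> i x $ n" for n
    using assms(1) x(2) a_nonneg[of i n] \<alpha>[of i n] by (simp add: \<gamma>_strict_mono) (simp add: \<gamma>)
  then show ?thesis
    using \<gamma>_T[OF assms(1) x(1)] by (auto simp: U_def mem_Qbox_T intro!: bexI[of _ "\<gamma> i x"])
qed

section \<open>Null sets and the overlaps of the tiles\<close>

lemma \<gamma>_null:
  assumes "i \<in> I" "N \<in> null_sets lborel"
  shows "\<gamma> i ` N \<in> null_sets lborel" "\<gamma> i -` N \<in> null_sets lborel"
proof -
  show "\<gamma> i ` N \<in> null_sets lborel"
    using assms \<gamma>_borel[of i N] emeasure_\<gamma>[of i N] by (auto simp: null_sets_def)
  have "\<gamma> i \<in> borel_measurable borel"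
    using assms(1) by (intro borel_measurable_continuous_onI continuous_\<gamma>)
  then have borel: "\<gamma> i -` N \<in> sets borel"
    using measurable_sets[of "\<gamma> i" borel borel N] assms(2) by (auto simp: null_sets_def)
  have "\<gamma> i ` (\<gamma> i -` N) = N" using surj_\<gamma>[OF assms(1)] by (rule surj_image_vimage_eq)
  then have "ennreal (p i) * emeasure lborel (\<gamma> i -` N) = 0"
    using emeasure_\<gamma>[OF assms(1) borel] assms(2) by (auto simp: null_sets_def)
  then show "\<gamma> i -` N \<in> null_sets lborel"
    using borel p_pos[OF assms(1)] by (auto simp: null_sets_def)
qed

lemma \<gamma>_T_borel: "i \<in> I \<Longrightarrow> \<gamma> i ` T \<in> sets borel"
  using \<gamma>_borel T_borel by blast

lemma overlap_null:
  "(\<Union>i\<in>I. \<Union>j\<in>I - {i}. \<gamma> i -` (\<gamma> i ` T \<inter> \<gamma> j ` T)) \<in> null_sets lborel"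
  using countable_I overlap \<gamma>_T_borel
  by (intro null_sets_UN' \<gamma>_null) (auto simp: null_sets_def)

lemma A_subset_T: "A \<subseteq> T"
  by (auto simp: A_def Aset_def)

lemma A_borel: "A \<in> sets borel"
  unfolding A_def Aset_def using overlap_null T_borel by (auto simp: null_sets_def)

lemma T_minus_A_null: "T - A \<in> null_sets lborel"
proof (rule null_sets_subset[OF overlap_null])
  show "T - A \<in> sets lborel" using A_borel T_borel by simp
  show "T - A \<subseteq> (\<Union>i\<in>I. \<Union>j\<in>I - {i}. \<gamma> i -` (\<gamma> i ` T \<inter> \<gamma> j ` T))"
    by (auto simp: A_def Aset_def)
qed

lemma disjoint_\<gamma>_A:
  assumes "i \<in> I" "j \<in> I" "i \<noteq> j"
  shows "\<gamma> i ` A \<inter> \<gamma> j ` A = {}"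
proof (rule ccontr)
  assume "\<gamma> i ` A \<inter> \<gamma> j ` A \<noteq> {}"
  then obtain y z where "y \<in> A" "z \<in> A" "\<gamma> i y = \<gamma> j z" by auto
  then have "\<gamma> i y \<in> \<gamma> i ` T \<inter> \<gamma> j ` T" using A_subset_T by blast
  then have "y \<notin> A" using assms by (auto simp: A_def Aset_def)
  then show False using \<open>y \<in> A\<close> by blast
qed

lemma disjoint_family_\<gamma>: "disjoint_family_on (\<lambda>i. \<gamma> i ` (E \<inter> A)) I"
  using disjoint_\<gamma>_A by (fastforce simp: disjoint_family_on_def)

lemma \<gamma>_A_subset_T: "(\<Union>i\<in>I. \<gamma> i ` A) \<subseteq> T"
  using A_subset_T \<gamma>_T by blast

text \<open>The points of \<open>T\<close> that \<open>gmap\<close> sends to its default value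
  0.\<close>

definition N0 :: "(real^'n) set" where "N0 = T - (\<Union>i\<in>I. \<gamma> i ` A)"

lemma union_borel: "E \<in> sets borel \<Longrightarrow> (\<Union>i\<in>I. \<gamma> i ` E) \<in> sets borel"
  using countable_I \<gamma>_borel by (intro sets.countable_UN') auto

lemma N0_null: "N0 \<in> null_sets lborel"
proof (rule null_sets_subset)
  have "sym_diff T (\<Union>i\<in>I. \<gamma> i ` T) \<in> null_sets lborel"
    using cover T_borel union_borel by (auto simp: null_sets_def)
  moreover have "(\<Union>i\<in>I. \<gamma> i ` (T - A)) \<in> null_sets lborel"
    using countable_I T_minus_A_null by (intro null_sets_UN' \<gamma>_null) auto
  ultimately show "sym_diff T (\<Union>i\<in>I. \<gamma> i ` T) \<union> (\<Union>i\<in>I. \<gamma> i ` (T - A)) \<in> null_sets lborel"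
    by (rule null_sets.Un)
  show "N0 \<in> sets lborel" using T_borel union_borel[OF A_borel] by (simp add: N0_def)
  show "N0 \<subseteq> sym_diff T (\<Union>i\<in>I. \<gamma> i ` T) \<union> (\<Union>i\<in>I. \<gamma> i ` (T - A))"
    by (auto simp: N0_def)
qed

section \<open>Preimages under the piecewise inverse map\<close>

lemma gmap_\<gamma>:
  assumes "i \<in> I" "y \<in> A"
  shows "gmap I \<gamma> T (\<gamma> i y) = y"
proof -
  have "(THE j. j \<in> I \<and> \<gamma> i y \<in> \<gamma> j ` A) = i"
    using assms disjoint_\<gamma>_A by (intro the_equality) auto
  moreover have "\<exists>j\<in>I. \<gamma> i y \<in> \<gamma> j ` A" using assms by auto
  ultimately show ?thesis
    using inj_\<gamma>[OF assms(1)] by (simp add: gmap_def flip: A_def)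
qed

lemma gmap_preimage:
  "{x \<in> T. gmap I \<gamma> T x \<in> E} = (\<Union>i\<in>I. \<gamma> i ` (E \<inter> A)) \<union> (if 0 \<in> E then N0 else {})"
proof (rule set_eqI)
  fix x
  show "x \<in> {x \<in> T. gmap I \<gamma> T x \<in> E} \<longleftrightarrow>
    x \<in> (\<Union>i\<in>I. \<gamma> i ` (E \<inter> A)) \<union> (if 0 \<in> E then N0 else {})"
  proof (cases "\<exists>i\<in>I. \<exists>y\<in>A. x = \<gamma> i y")
    case True
    then obtain i y where i: "i \<in> I" and y: "y \<in> A" and x: "x = \<gamma> i y" by blast
    have "x \<in> T" using i y \<gamma>_T A_subset_T by (auto simp: x)
    moreover have "x \<in> (\<Union>i\<in>I. \<gamma> i ` (E \<inter> A)) \<longleftrightarrow> y \<in> E"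
    proof
      assume "x \<in> (\<Union>i\<in>I. \<gamma> i ` (E \<inter> A))"
      then obtain j z where "j \<in> I" "z \<in> E" "z \<in> A" "\<gamma> i y = \<gamma> j z" by (auto simp: x)
      then show "y \<in> E" using gmap_\<gamma>[OF i y] gmap_\<gamma>[of j z] by simp
    qed (use i y in \<open>auto simp: x\<close>)
    moreover have "x \<notin> N0" using i y by (auto simp: N0_def x)
    ultimately show ?thesis using gmap_\<gamma>[OF i y] by (simp add: x)
  next
    case False
    then have "gmap I \<gamma> T x = 0" by (auto simp: gmap_def simp flip: A_def)
    moreover have "x \<notin> (\<Union>i\<in>I. \<gamma> i ` (E \<inter> A))" "x \<in> N0 \<longleftrightarrow> x \<in> T"
      using False by (auto simp: N0_def)
    ultimately show ?thesis by simp
  qed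
qed

lemma gmap_preimage_borel: "E \<in> sets borel \<Longrightarrow> {x \<in> T. gmap I \<gamma> T x \<in> E} \<in> sets borel"
  unfolding gmap_preimage using N0_null A_borel
  by (intro sets.Un union_borel) (simp_all add: null_sets_def)

text \<open>The default part \<open>N0\<close> and the images of \<open>E - A\<close> are Lebesgue
  null, so \<nu> ignores them; the images of \<open>E \<inter> A\<close> are disjoint and \<nu> is
  countably additive.\<close>

lemma emeasure_gmap_preimage:
  assumes \<nu>: "sets \<nu> = sets (restrict_space borel T)"
    and null: "\<And>N. N \<in> null_sets lborel \<Longrightarrow> N \<subseteq> T \<Longrightarrow> emeasure \<nu> N = 0"
    and E: "E \<in> sets borel" "E \<subseteq> T"
  shows "emeasure \<nu> {x \<in> T. gmap I \<gamma> T x \<in> E} = (\<integral>\<^sup>+i. emeasure \<nu> (\<gamma> i ` E) \<partial>count_space I)"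
proof -
  have sets: "S \<in> sets \<nu> \<longleftrightarrow> S \<in> sets borel \<and> S \<subseteq> T" for S
    using sets_restrict_space_iff[of T borel S] T_borel by (simp add: \<nu> conj_commute)
  have null': "N \<in> null_sets \<nu>" if "N \<in> null_sets lborel" "N \<subseteq> T" for N
    using that null[OF that] by (simp add: null_sets_def sets)
  have EA: "\<gamma> i ` (E \<inter> A) \<in> sets \<nu>" if "i \<in> I" for i
    using \<gamma>_borel[OF that, of "E \<inter> A"] E(1) A_borel \<gamma>_A_subset_T that by (simp add: sets) blast
  have "(if 0 \<in> E then N0 else {}) \<in> null_sets \<nu>"
    using null'[OF N0_null] by (auto simp: N0_def)
  then have "emeasure \<nu> {x \<in> T. gmap I \<gamma> T x \<in> E} = emeasure \<nu> (\<Union>i\<in>I. \<gamma> i ` (E \<inter> A))"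
    unfolding gmap_preimage using EA countable_I
    by (intro emeasure_Un_null_set sets.countable_UN') blast+
  also have "\<dots> = (\<integral>\<^sup>+i. emeasure \<nu> (\<gamma> i ` (E \<inter> A)) \<partial>count_space I)"
    using EA countable_I disjoint_family_\<gamma> by (intro emeasure_UN_countable) auto
  also have "\<dots> = (\<integral>\<^sup>+i. emeasure \<nu> (\<gamma> i ` E) \<partial>count_space I)"
  proof (rule nn_integral_cong)
    fix i assume "i \<in> space (count_space I)"
    then have i: "i \<in> I" by simp
    have "E - A \<in> null_sets lborel"
      using T_minus_A_null by (rule null_sets_subset) (use E A_borel in auto)
    then have "\<gamma> i ` (E - A) \<in> null_sets \<nu>"
      using i E \<gamma>_T by (intro null' \<gamma>_null) blast+
    then have "emeasure \<nu> (\<gamma> i ` (E \<inter> A) \<union> \<gamma> i ` (E - A)) = emeasure \<nu> (\<gamma> i ` (E \<inter> A))"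
      using EA[OF i] by (intro emeasure_Un_null_set)
    moreover have "\<gamma> i ` (E \<inter> A) \<union> \<gamma> i ` (E - A) = \<gamma> i ` E" by auto
    ultimately show "emeasure \<nu> (\<gamma> i ` (E \<inter> A)) = emeasure \<nu> (\<gamma> i ` E)" by simp
  qed
  finally show ?thesis .
qed

text \<open>Up to null sets \<open>T\<close> is the disjoint union of the images of
  \<open>A\<close>, and \<open>A\<close> has the measure of \<open>T\<close>. That measure is
  positive and finite, so it cancels.\<close>

lemma nn_integral_p: "(\<integral>\<^sup>+i. ennreal (p i) \<partial>count_space I) = 1"
proof -
  have "emeasure lborel T = emeasure lborel ((\<Union>i\<in>I. \<gamma> i ` A) \<union> N0)"
    using \<gamma>_A_subset_T by (simp add: N0_def Un_absorb1)
  also have "\<dots> = emeasure lborel (\<Union>i\<in>I. \<gamma> i ` (A \<inter> A))"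
    using N0_null union_borel[OF A_borel] by (simp add: emeasure_Un_null_set)
  also have "\<dots> = (\<integral>\<^sup>+i. emeasure lborel (\<gamma> i ` (A \<inter> A)) \<partial>count_space I)"
    using countable_I disjoint_family_\<gamma>[of A] A_borel \<gamma>_borel by (intro emeasure_UN_countable) auto
  also have "\<dots> = (\<integral>\<^sup>+i. ennreal (p i) * emeasure lborel A \<partial>count_space I)"
    using A_borel by (intro nn_integral_cong) (simp add: emeasure_\<gamma>)
  also have "\<dots> = (\<integral>\<^sup>+i. ennreal (p i) \<partial>count_space I) * emeasure lborel A"
    by (rule nn_integral_multc) simp
  also have "emeasure lborel A = emeasure lborel T"
  proof -
    have "emeasure lborel (A \<union> (T - A)) = emeasure lborel A"
      using T_minus_A_null A_borel by (intro emeasure_Un_null_set) auto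
    moreover have "A \<union> (T - A) = T" using A_subset_T by auto
    ultimately show ?thesis by simp
  qed
  finally have "(\<integral>\<^sup>+i. ennreal (p i) \<partial>count_space I) * emeasure lborel T = 1 * emeasure lborel T"
    by simp
  then show ?thesis
    using T_pos emeasure_T_finite ennreal_mult_divide_eq[of "emeasure lborel T"]
    by (metis infinity_ennreal_def less_irrefl)
qed

lemma has_sum_p: "(p has_sum 1) I"
  using nn_integral_count_space_eq_iff_has_sum[of I p 1] nn_integral_p p_pos by (simp add: less_imp_le)

end

section \<open>Measures with a continuous density\<close>

text \<open>\<open>F\<close> extends the distribution function and \<open>h\<close> is its mixed
  partial derivative in all coordinates, which turns out to be the density of \<nu> on the boxes in
  \<open>U\<close>.\<close>

locale density = down_closed T for T :: "((real, 'n::{finite,linorder}) vec) set" +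
  fixes \<nu> :: "((real, 'n) vec) measure" and F h :: "(real, 'n) vec \<Rightarrow> real"
  assumes sets_\<nu>: "sets \<nu> = sets (restrict_space borel T)"
    and finite_Qbox: "\<And>x. x \<in> T \<Longrightarrow> emeasure \<nu> (Qbox 0 x) < \<infinity>"
    and outer: "emeasure \<nu> (T - U) = 0"
    and F: "\<And>x. x \<in> T \<Longrightarrow> F x = distrib \<nu> x"
    and mixed: "has_mixed_partial (sorted_list_of_set UNIV) F h"
    and continuous_h: "continuous_on UNIV h"
begin

lemma sets_\<nu>_iff: "E \<in> sets \<nu> \<longleftrightarrow> E \<in> sets borel \<and> E \<subseteq> T"
  using sets_restrict_space_iff[of T borel E] T_borel by (simp add: sets_\<nu> conj_commute)

lemma emeasure_\<nu>_subset_Qbox: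
  assumes "x \<in> T" "E \<subseteq> Qbox 0 x"
  shows "emeasure \<nu> E = ennreal (measure \<nu> E)"
proof (rule emeasure_eq_ennreal_measure)
  have "emeasure \<nu> E \<le> emeasure \<nu> (Qbox 0 x)"
    using assms Qbox_T_borel Qbox_subset_T by (intro emeasure_mono) (auto simp: sets_\<nu>_iff)
  also have "\<dots> < \<infinity>" by (rule finite_Qbox) fact
  finally show "emeasure \<nu> E \<noteq> top" by auto
qed

lemma square_distrib:
  assumes "corners x y \<subseteq> T"
  shows "square (distrib \<nu>) x y = square F x y"
proof -
  have "pi_pt M x y \<in> T" for M
    using assms by (rule subsetD) (simp add: corners_def pi_pt_def)
  then show ?thesis by (simp add: square_def F)
qed

lemma distrib_degenerate: "x $ k = 0 \<Longrightarrow> distrib \<nu> x = 0"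
  using Qbox_degenerate[of 0 k x] by (simp add: distrib_def)

text \<open>All corners of the box lie in \<open>T\<close>, where \<open>F\<close> is the
  distribution function; at every corner but \<open>x\<close> some coordinate is 0 and the
  distribution function vanishes. The mixed difference of \<open>F\<close> is thus its value at
  \<open>x\<close>, and also the integral of \<open>h\<close>.\<close>

lemma measure_Qbox_0:
  assumes x: "x \<in> T" "\<And>n. 0 < x $ n"
  shows "measure \<nu> (Qbox 0 x) = (LINT z:Qbox 0 x|lborel. h z)"
proof -
  have "z \<in> T" if "z \<in> corners 0 x" for z
    using x(1)
  proof (rule closed_box_subset_T)
    fix n
    have "z $ n = 0 \<or> z $ n = x $ n" using that by (simp add: corners_def)
    then show "0 \<le> z $ n" "z $ n \<le> x $ n" using x(2)[of n] by auto
  qed (rule x(2))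
  then have "square (distrib \<nu>) 0 x = square F 0 x"
    by (intro square_distrib) blast
  moreover have "square (distrib \<nu>) 0 x = distrib \<nu> x"
  proof (rule square_eq_at_upper_corner)
    fix M :: "'n set" assume "M \<noteq> {}"
    then obtain k where "k \<in> M" by auto
    then show "distrib \<nu> (pi_pt M 0 x) = 0"
      by (intro distrib_degenerate[of _ k]) (simp add: pi_pt_def)
  qed
  ultimately show ?thesis
    using set_integral_Qbox_eq_square[OF mixed continuous_h, of 0 x] x(2)
    by (simp add: distrib_def less_imp_le)
qed

lemma measure_sums:
  assumes "x \<in> T" "disjoint_family A" "\<And>i. A i \<in> sets borel" "\<And>i. A i \<subseteq> Qbox 0 x"
  shows "(\<lambda>i::nat. measure \<nu> (A i)) sums measure \<nu> (\<Union>i. A i)"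
proof (rule measure_UNION)
  show "range A \<subseteq> sets \<nu>"
    using assms(3) order_trans[OF assms(4) Qbox_subset_T[OF assms(1)]]
    by (simp add: sets_\<nu>_iff image_subset_iff)
  show "emeasure \<nu> (\<Union>i. A i) \<noteq> \<infinity>"
    using emeasure_\<nu>_subset_Qbox[OF assms(1), of "\<Union>i. A i"] assms(4) by (simp add: UN_least)
qed fact

text \<open>Both sides are countably additive within the box and agree on the smaller boxes at 0, so
  \<open>additive_zero_on_boxes\<close> applies to their difference.\<close>

lemma measure_eq_set_integral:
  assumes x: "x \<in> T" and E: "E \<in> sets borel" "E \<subseteq> Qbox 0 x"
  shows "measure \<nu> E = (LINT z:E|lborel. h z)"
proof (cases "\<forall>n. 0 < x $ n")
  case False
  then obtain k where "x $ k = 0" using T_nonneg[OF x] by (metis less_eq_real_def)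
  then have "E = {}" using E(2) Qbox_degenerate[of 0 k x] by auto
  then show ?thesis by (simp add: set_lebesgue_integral_def)
next
  case True
  let ?\<phi> = "\<lambda>E. measure \<nu> E - (LINT z:E|lborel. h z)"
  have "?\<phi> E = 0"
  proof (rule additive_zero_on_boxes[of x ?\<phi>])
    fix A :: "nat \<Rightarrow> (real, 'n) vec set"
    assume A: "disjoint_family A" "\<And>i. A i \<in> sets borel" "\<And>i. A i \<subseteq> Qbox 0 x"
    have "set_integrable lborel (\<Union>i. A i) h"
      using A True by (intro set_integrable_Qbox[OF continuous_h, of 0 x]) (auto simp: less_imp_le)
    then show "(\<lambda>i. ?\<phi> (A i)) sums ?\<phi> (\<Union>i. A i)"
      using A by (intro sums_diff measure_sums[OF x] set_integral_sums) auto
  next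
    fix y assume y: "\<And>n. 0 < y $ n \<and> y $ n \<le> x $ n"
    have "y \<in> T" by (rule closed_box_subset_T[OF x]) (use True y less_imp_le in blast)+
    then show "?\<phi> (Qbox 0 y) = 0" using measure_Qbox_0 y by simp
  qed (use True E in auto)
  then show ?thesis by simp
qed

text \<open>Inside each of countably many boxes \<nu> is an integral against Lebesgue measure; the
  rest of \<open>N\<close> lies in \<open>T - U\<close>, which has no mass.\<close>

lemma \<nu>_null:
  assumes N: "N \<in> null_sets lborel" "N \<subseteq> T"
  shows "emeasure \<nu> N = 0"
proof -
  obtain C where C: "countable C" "C \<subseteq> T" "U = (\<Union>x\<in>C. Qbox 0 x)" by (rule countable_cover)
  have "N \<inter> Qbox 0 x \<in> null_sets \<nu>" if x: "x \<in> C" for x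
  proof -
    have borel: "N \<inter> Qbox 0 x \<in> sets borel"
      using N(1) x C(2) Qbox_T_borel[of x] by (intro sets.Int) (auto simp: null_sets_def)
    have "AE z in lborel. z \<notin> N" using N(1) by (rule AE_not_in)
    then have "(LINT z:N \<inter> Qbox 0 x|lborel. h z) = 0"
      unfolding set_lebesgue_integral_def
      by (intro integral_eq_zero_AE) (auto elim!: eventually_mono)
    then have "measure \<nu> (N \<inter> Qbox 0 x) = 0"
      using measure_eq_set_integral[of x] borel x C(2) by auto
    then show ?thesis
      using emeasure_\<nu>_subset_Qbox[of x "N \<inter> Qbox 0 x"] borel x C(2) N(2)
      by (auto simp: null_sets_def sets_\<nu>_iff)
  qed
  moreover have "T - U \<in> null_sets \<nu>"
    using outer T_borel U_borel by (auto simp: null_sets_def sets_\<nu>_iff)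
  ultimately have "(\<Union>x\<in>C. N \<inter> Qbox 0 x) \<union> (T - U) \<in> null_sets \<nu>"
    using C(1) by (intro null_sets.Un null_sets_UN')
  moreover have "N \<in> sets \<nu>" using N by (auto simp: sets_\<nu>_iff)
  moreover have "N \<subseteq> (\<Union>x\<in>C. N \<inter> Qbox 0 x) \<union> (T - U)" using C(3) N(2) by auto
  ultimately have "N \<in> null_sets \<nu>" by (metis null_sets_subset)
  then show ?thesis by auto
qed

text \<open>Serves the boxes with corners \<open>\<gamma> i 0\<close> and
  \<open>\<gamma> i x\<close>: admissibility puts all their corners into \<open>T\<close>.\<close>

lemma measure_Qbox:
  assumes "\<And>n. 0 \<le> x $ n" "\<And>n. x $ n \<le> y $ n" "corners x y \<subseteq> T"
  shows "measure \<nu> (Qbox x y) = square (distrib \<nu>) x y"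
proof -
  have y: "y \<in> T" using assms(3) by (auto simp: corners_def)
  have "Qbox x y \<subseteq> Qbox 0 y"
    using assms(1) by (auto simp: mem_Qbox[OF assms(2)] mem_Qbox_T[OF y]) (meson order_trans)
  then have "measure \<nu> (Qbox x y) = (LINT z:Qbox x y|lborel. h z)"
    using y assms(2) by (intro measure_eq_set_integral Qbox_borel)
  then show ?thesis
    using set_integral_Qbox_eq_square[OF mixed continuous_h assms(2)] square_distrib[OF assms(3)] by simp
qed

lemma set_integrable_h:
  assumes "x \<in> T" "E \<in> sets borel" "E \<subseteq> Qbox 0 x"
  shows "set_integrable lborel E h"
  using assms T_nonneg by (intro set_integrable_Qbox[OF continuous_h, of 0 x]) auto

lemma emeasure_lborel_subset_Qbox:
  assumes "x \<in> T" "E \<subseteq> Qbox 0 x"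
  shows "emeasure lborel E = ennreal (measure lborel E)"
proof (rule emeasure_eq_ennreal_measure)
  have "emeasure lborel E \<le> emeasure lborel T"
    using assms Qbox_subset_T T_borel by (intro emeasure_mono) auto
  then show "emeasure lborel E \<noteq> top" using emeasure_T_finite by auto
qed

text \<open>A pointwise bound on the density of s \<nu> + c \<mu> is integrated over
  \<open>E\<close>. As \<open>s\<close>, \<open>c\<close> and \<open>d\<close> may have any sign,
  upper bounds follow by negating all three.\<close>

lemma linear_lower_bound:
  assumes x: "x \<in> T" and E: "E \<in> sets borel" "E \<subseteq> Qbox 0 x"
    and d: "\<And>z. z \<in> E \<Longrightarrow> d \<le> s * h z + c"
  shows "d * measure lborel E \<le> s * measure \<nu> E + c * measure lborel E"
proof -
  have fin: "emeasure lborel E \<noteq> \<infinity>"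
    using emeasure_lborel_subset_Qbox[OF x E(2)] by simp
  have const: "(LINT z:E|lborel. r) = r * measure lborel E" "set_integrable lborel E (\<lambda>_. r)" for r :: real
    using set_integral_const[of E lborel r] E(1) fin
    by (auto simp: set_integrable_def less_top mult.commute)
  have "d * measure lborel E = (LINT z:E|lborel. d)" by (simp add: const)
  also have "\<dots> \<le> (LINT z:E|lborel. s * h z + c)"
    using set_integrable_h[OF x E] const(2) d
    by (intro set_integral_mono set_integral_add set_integrable_mult_right) auto
  also have "\<dots> = s * measure \<nu> E + c * measure lborel E"
    using set_integrable_h[OF x E] const(2)
    by (subst set_integral_add) (auto simp: const measure_eq_set_integral[OF x E])
  finally show ?thesis .
qed

end

section \<open>Invariant densities\<close>

locale tiled_density = tiling T I \<gamma> \<alpha> a + density T \<nu> F h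
  for T :: "((real, 'n::{finite,linorder}) vec) set" and I :: "'i set" and \<gamma> \<alpha> a \<nu> F h
begin

section \<open>The fixed-point equation as invariance on boxes\<close>

definition invariant_on_boxes :: bool where
  "invariant_on_boxes \<longleftrightarrow> (\<forall>x\<in>T. (\<forall>n. 0 < x $ n) \<longrightarrow>
     emeasure \<nu> {z \<in> T. gmap I \<gamma> T z \<in> Qbox 0 x} = emeasure \<nu> (Qbox 0 x))"

lemma \<gamma>_subset_Qbox:
  assumes "i \<in> I" "x \<in> T" "E \<subseteq> Qbox 0 x"
  shows "\<gamma> i ` E \<subseteq> Qbox 0 (\<gamma> i x)"
proof
  fix y assume "y \<in> \<gamma> i ` E"
  then obtain z where z: "z \<in> E" "y = \<gamma> i z" by auto
  then have z': "\<forall>n. 0 \<le> z $ n \<and> z $ n < x $ n" using assms by (auto simp: mem_Qbox_T)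
  have "0 \<le> y $ n" for n
    using z' assms(1) a_nonneg[of i n] \<alpha>[of i n] by (simp add: z(2) \<gamma>)
  moreover have "y $ n < \<gamma> i x $ n" for n
    using z' assms(1) by (simp add: z(2) \<gamma>_strict_mono)
  ultimately show "y \<in> Qbox 0 (\<gamma> i x)"
    using \<gamma>_T[OF assms(1,2)] by (simp add: mem_Qbox_T)
qed

text \<open>\<open>E\<close> and its images lie in boxes with upper corners in \<open>T\<close>,
  where \<nu> is finite, so the equation of extended values becomes an unordered sum of
  reals.\<close>

lemma preimage_eq_iff_has_sum:
  assumes "x \<in> T" "E \<in> sets borel" "E \<subseteq> Qbox 0 x"
  shows "emeasure \<nu> {z \<in> T. gmap I \<gamma> T z \<in> E} = emeasure \<nu> E \<longleftrightarrow>
    ((\<lambda>i. measure \<nu> (\<gamma> i ` E)) has_sum measure \<nu> E) I"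
proof -
  have "emeasure \<nu> {z \<in> T. gmap I \<gamma> T z \<in> E} = (\<integral>\<^sup>+i. emeasure \<nu> (\<gamma> i ` E) \<partial>count_space I)"
    using assms Qbox_subset_T[OF assms(1)] by (intro emeasure_gmap_preimage sets_\<nu> \<nu>_null) auto
  also have "\<dots> = (\<integral>\<^sup>+i. ennreal (measure \<nu> (\<gamma> i ` E)) \<partial>count_space I)"
  proof (rule nn_integral_cong)
    fix i assume "i \<in> space (count_space I)"
    then show "emeasure \<nu> (\<gamma> i ` E) = ennreal (measure \<nu> (\<gamma> i ` E))"
      using \<gamma>_subset_Qbox[OF _ assms(1,3), of i] assms(1) by (intro emeasure_\<nu>_subset_Qbox[of "\<gamma> i x"] \<gamma>_T) auto
  qed
  finally show ?thesis
    using nn_integral_count_space_eq_iff_has_sum[of I "\<lambda>i. measure \<nu> (\<gamma> i ` E)" "measure \<nu> E"]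
      emeasure_\<nu>_subset_Qbox[OF assms(1,3)] by simp
qed

lemma square_\<gamma>:
  assumes "i \<in> I" "x \<in> T"
  shows "square (distrib \<nu>) (\<gamma> i 0) (\<gamma> i x) = measure \<nu> (\<gamma> i ` Qbox 0 x)"
proof -
  have "measure \<nu> (Qbox (\<gamma> i 0) (\<gamma> i x)) = square (distrib \<nu>) (\<gamma> i 0) (\<gamma> i x)"
    using assms T_nonneg \<gamma>_T zero_in_T by (intro measure_Qbox \<gamma>_corners) (auto simp: \<gamma>_mono)
  then show ?thesis using assms T_nonneg by (subst \<gamma>_Qbox) auto
qed

text \<open>Convergence and value of the series together form one \<open>has_sum\<close> statement,
  whose terms are the masses of the images of the box. Boxes whose upper corner has a zero
  coordinate are empty, so restricting to positive \<open>x\<close> loses nothing.\<close>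

lemma Mop_fixed_iff:
  "Mop_converges I \<gamma> T (distrib \<nu>) \<and> (\<forall>x\<in>T. Mop I \<gamma> (distrib \<nu>) x = distrib \<nu> x) \<longleftrightarrow> invariant_on_boxes"
proof -
  have "Mop_converges I \<gamma> T (distrib \<nu>) \<and> (\<forall>x\<in>T. Mop I \<gamma> (distrib \<nu>) x = distrib \<nu> x) \<longleftrightarrow>
    (\<forall>x\<in>T. ((\<lambda>i. square (distrib \<nu>) (\<gamma> i 0) (\<gamma> i x)) has_sum distrib \<nu> x) I)"
    by (auto simp: Mop_converges_def Mop_def has_sum_iff)
  also have "\<dots> \<longleftrightarrow> (\<forall>x\<in>T. ((\<lambda>i. measure \<nu> (\<gamma> i ` Qbox 0 x)) has_sum measure \<nu> (Qbox 0 x)) I)"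
    unfolding distrib_def[of \<nu> "_"]
    by (intro ball_cong refl has_sum_cong) (simp add: square_\<gamma>[unfolded distrib_def])
  also have "\<dots> \<longleftrightarrow> (\<forall>x\<in>T. emeasure \<nu> {z \<in> T. gmap I \<gamma> T z \<in> Qbox 0 x} = emeasure \<nu> (Qbox 0 x))"
    by (intro ball_cong refl preimage_eq_iff_has_sum[symmetric]) (auto intro: Qbox_T_borel)
  also have "\<dots> \<longleftrightarrow> invariant_on_boxes"
    unfolding invariant_on_boxes_def
  proof (intro ball_cong refl)
    fix x assume x: "x \<in> T"
    have "Qbox 0 x = {}" if "\<not> (\<forall>n. 0 < x $ n)"
    proof -
      from that obtain k where "\<not> 0 < x $ k" by blast
      then have "0 $ k = x $ k" using T_nonneg[OF x, of k] by simp
      then show ?thesis by (rule Qbox_degenerate)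
    qed
    then show "emeasure \<nu> {z \<in> T. gmap I \<gamma> T z \<in> Qbox 0 x} = emeasure \<nu> (Qbox 0 x) \<longleftrightarrow>
      ((\<forall>n. 0 < x $ n) \<longrightarrow> emeasure \<nu> {z \<in> T. gmap I \<gamma> T z \<in> Qbox 0 x} = emeasure \<nu> (Qbox 0 x))"
      by (cases "\<forall>n. 0 < x $ n") auto
  qed
  finally show ?thesis .
qed

lemma invariant_on_subsets:
  assumes inv: invariant_on_boxes and x: "x \<in> T" "\<And>n. 0 < x $ n"
    and E: "E \<in> sets borel" "E \<subseteq> Qbox 0 x"
  shows "emeasure \<nu> {z \<in> T. gmap I \<gamma> T z \<in> E} = emeasure \<nu> E"
proof -
  let ?g = "\<lambda>E. {z \<in> T. gmap I \<gamma> T z \<in> E}"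
  have g_sets: "?g E \<in> sets \<nu>" if "E \<in> sets borel" for E
    using gmap_preimage_borel[OF that] by (auto simp: sets_\<nu>_iff)
  have g_finite: "emeasure \<nu> (?g E) = ennreal (measure \<nu> (?g E))" if "E \<in> sets borel" "E \<subseteq> Qbox 0 x" for E
  proof (rule emeasure_eq_ennreal_measure)
    have "emeasure \<nu> (?g E) \<le> emeasure \<nu> (?g (Qbox 0 x))"
      using that g_sets[OF Qbox_T_borel[OF x(1)]] by (intro emeasure_mono) auto
    \<comment> \<open>Invariance on the whole box makes its preimage finite, so real-valued
      differences are meaningful for all Borel subsets.\<close>
    also have "\<dots> < \<infinity>" using inv x finite_Qbox[OF x(1)] by (simp add: invariant_on_boxes_def)
    finally show "emeasure \<nu> (?g E) \<noteq> top" by auto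
  qed
  let ?\<phi> = "\<lambda>E. measure \<nu> E - measure \<nu> (?g E)"
  have "?\<phi> E = 0"
  proof (rule additive_zero_on_boxes[of x ?\<phi>])
    fix A :: "nat \<Rightarrow> (real, 'n) vec set"
    assume A: "disjoint_family A" "\<And>i. A i \<in> sets borel" "\<And>i. A i \<subseteq> Qbox 0 x"
    have "(\<lambda>i. measure \<nu> (?g (A i))) sums measure \<nu> (\<Union>i. ?g (A i))"
    proof (rule measure_UNION)
      show "range (\<lambda>i. ?g (A i)) \<subseteq> sets \<nu>" using A(2) g_sets by auto
      show "disjoint_family (\<lambda>i. ?g (A i))" using A(1) by (auto simp: disjoint_family_on_def)
      have "(\<Union>i. ?g (A i)) = ?g (\<Union>i. A i)" by auto
      then show "emeasure \<nu> (\<Union>i. ?g (A i)) \<noteq> \<infinity>"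
        using g_finite[of "\<Union>i. A i"] A by (simp add: UN_least)
    qed
    moreover have "(\<Union>i. ?g (A i)) = ?g (\<Union>i. A i)" by auto
    ultimately show "(\<lambda>i. ?\<phi> (A i)) sums ?\<phi> (\<Union>i. A i)"
      using measure_sums[OF x(1) A] by (simp add: sums_diff)
  next
    fix y assume y: "\<And>n. 0 < y $ n \<and> y $ n \<le> x $ n"
    have "y \<in> T" by (rule closed_box_subset_T[OF x]) (use y less_imp_le in blast)+
    then show "?\<phi> (Qbox 0 y) = 0" using inv y by (simp add: invariant_on_boxes_def measure_def)
  qed (use x E in auto)
  then show ?thesis
    using emeasure_\<nu>_subset_Qbox[OF x(1) E(2)] g_finite[OF E] by simp
qed

text \<open>On small boxes \<open>E\<close> at \<open>z\<close>, the measure \<open>s \<nu> + c \<mu>\<close> of \<open>E\<close> is the sum over \<open>j\<close> of that of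
  \<open>\<gamma> j ` E\<close>; all terms are nonnegative, so the term for \<open>i\<close> alone is a lower bound.\<close>

lemma density_transfer_bound:
  assumes inv: invariant_on_boxes and i: "i \<in> I" and z: "z \<in> U"
    and nonneg: "\<And>y. y \<in> U \<Longrightarrow> 0 \<le> s * h y + c"
  shows "p i * (s * h (\<gamma> i z) + c) \<le> s * h z + c"
proof (rule ccontr)
  let ?k = "\<lambda>y. s * h y + c"
  assume "\<not> ?thesis"
  \<comment> \<open>Two values \<open>d < d'\<close> are inserted into the gap: by continuity both
    strict inequalities persist near \<open>z\<close>, and a gap remains after integration.\<close>
  then obtain d where d: "?k z < d" "d < p i * ?k (\<gamma> i z)"
    using dense[of "?k z" "p i * ?k (\<gamma> i z)"] by auto
  obtain d' where d': "d < d'" "d' < p i * ?k (\<gamma> i z)" using dense[OF d(2)] by auto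
  then have d'_p: "d' / p i < ?k (\<gamma> i z)"
    using p_pos[OF i] by (simp add: divide_less_eq mult.commute)
  have "continuous_on UNIV (\<lambda>y. h (\<gamma> i y))"
    using continuous_on_compose2[OF continuous_h continuous_\<gamma>[OF i, of UNIV]] by simp
  then have "open ({y. ?k y < d} \<inter> {y. d' / p i < ?k (\<gamma> i y)})"
    using continuous_h by (intro open_Int open_Collect_less continuous_intros) auto
  then obtain e where e: "e > 0" "ball z e \<subseteq> {y. ?k y < d} \<inter> {y. d' / p i < ?k (\<gamma> i y)}"
    using openE[of _ z] d(1) d'_p by (metis (no_types, lifting) IntI mem_Collect_eq)
  obtain x where x: "x \<in> T" "\<And>n. 0 \<le> z $ n" "\<And>n. z $ n < x $ n"
    using z by (auto simp: U_def mem_Qbox_T)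
  have x_pos: "0 < x $ n" for n using x(2,3)[of n] by linarith
  \<comment> \<open>With sides at most \<delta>, points of the box have l1 distance at most e/2 from
    \<open>z\<close>, so the box stays in the ball.\<close>
  define \<delta> where "\<delta> = e / (2 * real CARD('n))"
  have "\<delta> > 0" using e(1) by (simp add: \<delta>_def)
  define b where "b = (\<chi> n. min (x $ n) (z $ n + \<delta>))"
  have zb: "z $ n < b $ n" for n using x(3) \<open>\<delta> > 0\<close> by (simp add: b_def)
  define E where "E = Qbox z b"
  have memE: "y \<in> E \<longleftrightarrow> (\<forall>n. z $ n \<le> y $ n \<and> y $ n < b $ n)" for y
    unfolding E_def using zb by (intro mem_Qbox) (simp add: less_imp_le)
  have E_borel: "E \<in> sets borel"
    unfolding E_def using zb by (intro Qbox_borel) (simp add: less_imp_le)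
  have E_sub: "E \<subseteq> Qbox 0 x"
  proof
    fix y assume "y \<in> E"
    then have "z $ n \<le> y $ n" "y $ n < b $ n" "b $ n \<le> x $ n" for n by (auto simp: memE b_def)
    then show "y \<in> Qbox 0 x"
      using x(2) unfolding mem_Qbox_T[OF x(1)] by (meson order_trans less_le_trans)
  qed
  have E_ball: "E \<subseteq> ball z e"
  proof
    fix y assume y: "y \<in> E"
    have "norm (y - z) \<le> (\<Sum>n\<in>UNIV. \<bar>(y - z) $ n\<bar>)" by (rule norm_le_l1_cart)
    also have "\<dots> \<le> (\<Sum>n\<in>(UNIV :: 'n set). \<delta>)"
    proof (rule sum_mono)
      fix n
      have "z $ n \<le> y $ n" "y $ n < b $ n" "b $ n \<le> z $ n + \<delta>" using y by (auto simp: memE b_def)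
      then show "\<bar>(y - z) $ n\<bar> \<le> \<delta>" by simp
    qed
    also have "\<dots> < e" using e(1) by (simp add: \<delta>_def)
    finally show "y \<in> ball z e" by (simp add: dist_norm norm_minus_commute)
  qed
  define m where "m = measure lborel E"
  have "m > 0" unfolding m_def E_def using zb by (rule measure_Qbox_pos)
  have m_\<gamma>: "measure lborel (\<gamma> j ` E) = p j * m" if "j \<in> I" for j
    using emeasure_\<gamma>[OF that E_borel] p_pos[OF that] by (simp add: measure_def m_def enn2real_mult)
  have \<gamma>E: "\<gamma> j ` E \<in> sets borel" "\<gamma> j x \<in> T" "\<gamma> j ` E \<subseteq> Qbox 0 (\<gamma> j x)" if "j \<in> I" for j
    using \<gamma>_borel[OF that E_borel] \<gamma>_T[OF that x(1)] \<gamma>_subset_Qbox[OF that x(1) E_sub] by auto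
  let ?K = "\<lambda>j. s * measure \<nu> (\<gamma> j ` E) + c * (p j * m)"
  have "((\<lambda>j. measure \<nu> (\<gamma> j ` E)) has_sum measure \<nu> E) I"
    using invariant_on_subsets[OF inv x(1) x_pos E_borel E_sub]
      preimage_eq_iff_has_sum[OF x(1) E_borel E_sub] by simp
  moreover have "((\<lambda>j. p j * m) has_sum 1 * m) I"
    using has_sum_p by (rule has_sum_cmult_left)
  ultimately have sum: "(?K has_sum s * measure \<nu> E + c * (1 * m)) I"
    by (intro has_sum_add has_sum_cmult_right)
  have "0 \<le> ?K j" if "j \<in> I" for j
    using linear_lower_bound[OF \<gamma>E(2,1,3)[OF that], of 0 s c] nonneg \<gamma>_U[OF that] E_sub x(1) m_\<gamma>[OF that]
    by (force simp: U_def)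
  then have "sum ?K {i} \<le> s * measure \<nu> E + c * (1 * m)"
    using i by (intro finite_sum_le_has_sum[OF sum]) auto
  \<comment> \<open>The image of \<open>E\<close> under \<open>\<gamma> i\<close> has Lebesgue
    measure \<open>p i * m\<close>, so the scaling factor cancels.\<close>
  moreover have "d' / p i * (p i * m) \<le> ?K i"
    using linear_lower_bound[OF \<gamma>E(2,1,3)[OF i], of "d' / p i" s c] e(2) E_ball m_\<gamma>[OF i]
    by force
  \<comment> \<open>The upper bound \<open>d * m\<close> for the mass of \<open>E\<close>, with all
    signs reversed.\<close>
  moreover have "- d * m \<le> - s * measure \<nu> E + - c * m"
    using linear_lower_bound[OF x(1) E_borel E_sub, of "- d" "- s" "- c"] e(2) E_ball
    by (force simp: m_def)
  ultimately have "d' * m \<le> d * m" using p_pos[OF i] by simp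
  then show False using \<open>m > 0\<close> \<open>d < d'\<close> by simp
qed

section \<open>Constancy of the density\<close>

lemma U_nonempty: "U \<noteq> {}"
  using emeasure_T_minus_U T_pos by auto

lemma density_constant:
  assumes inv: invariant_on_boxes
  shows "\<exists>l. \<forall>z\<in>U. h z = l"
proof -
  obtain i where i: "i \<in> I" using I_nonempty by auto
  \<comment> \<open>The fixed point of \<open>\<gamma> i\<close>, solved for coordinatewise;
    \<open>1 - \<alpha> i $ n\<close> is positive.\<close>
  define w where "w = (\<chi> n. a i $ n / (1 - \<alpha> i $ n))"
  have iter_closure: "(\<gamma> i ^^ k) z \<in> closure U" if "z \<in> closure U" for k z
  proof -
    have "\<gamma> i ` closure U \<subseteq> closure U"
    proof (rule image_closure_subset)
      show "continuous_on (closure U) (\<gamma> i)" by (rule continuous_\<gamma>[OF i])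
      show "\<gamma> i ` U \<subseteq> closure U" using \<gamma>_U[OF i] closure_subset by auto
    qed simp
    then show ?thesis using that by (induction k) auto
  qed
  have iter_nth: "(\<gamma> i ^^ k) z $ n = w $ n + \<alpha> i $ n ^ k * (z $ n - w $ n)" for k z n
  proof (induction k)
    case (Suc k)
    have "1 - \<alpha> i $ n \<noteq> 0" using \<alpha>[OF i, of n] by simp
    then have "(1 - \<alpha> i $ n) * w $ n = a i $ n" by (simp add: w_def)
    then have w: "a i $ n = w $ n - \<alpha> i $ n * w $ n" by (simp add: left_diff_distrib)
    have "(\<gamma> i ^^ Suc k) z $ n = \<alpha> i $ n * (\<gamma> i ^^ k) z $ n + a i $ n"
      using \<gamma>[OF i, of "(\<gamma> i ^^ k) z"] by (simp only: funpow.simps comp_apply vec_lambda_beta)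
    then show ?case unfolding Suc.IH w by (simp add: algebra_simps)
  qed simp
  have iter_lim: "(\<lambda>k. (\<gamma> i ^^ k) z) \<longlonglongrightarrow> w" for z
  proof (rule vec_tendstoI)
    fix n
    have "(\<lambda>k. \<alpha> i $ n ^ k) \<longlonglongrightarrow> 0" using \<alpha>[OF i, of n] by (intro LIMSEQ_power_zero) simp
    then have "(\<lambda>k. w $ n + \<alpha> i $ n ^ k * (z $ n - w $ n)) \<longlonglongrightarrow> w $ n + 0 * (z $ n - w $ n)"
      by (intro tendsto_add tendsto_mult tendsto_const)
    then show "(\<lambda>k. (\<gamma> i ^^ k) z $ n) \<longlonglongrightarrow> w $ n" by (simp add: iter_nth)
  qed
  have extremal: "s * h w + c = 0"
    if nonneg: "\<And>y. y \<in> closure U \<Longrightarrow> 0 \<le> s * h y + c" and z: "z \<in> closure U" "s * h z + c = 0" for s c z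
  proof -
    let ?k = "\<lambda>y. s * h y + c"
    have "continuous_on UNIV (\<lambda>y. h (\<gamma> i y))"
      using continuous_on_compose2[OF continuous_h continuous_\<gamma>[OF i, of UNIV]] by simp
    \<comment> \<open>The transfer bound is known on \<open>U\<close>. Being a closed condition, it
      extends to \<open>closure U\<close>, where the extrema of \<open>h\<close> are
      attained.\<close>
    then have "closed {y. p i * ?k (\<gamma> i y) \<le> ?k y}"
      using continuous_h by (intro closed_Collect_le continuous_intros)
    moreover have "U \<subseteq> {y. p i * ?k (\<gamma> i y) \<le> ?k y}"
      using density_transfer_bound[OF inv i] nonneg closure_subset[of U] by blast
    ultimately have bound: "p i * ?k (\<gamma> i y) \<le> ?k y" if "y \<in> closure U" for y
      using closure_minimal that by blast
    have zero: "?k ((\<gamma> i ^^ n) z) = 0" for n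
    proof (induction n)
      case (Suc n)
      have "p i * ?k ((\<gamma> i ^^ Suc n) z) \<le> 0"
        using bound[OF iter_closure[OF z(1)], of n] Suc by simp
      then have "?k ((\<gamma> i ^^ Suc n) z) \<le> 0"
        using p_pos[OF i] by (simp add: mult_le_0_iff)
      then show ?case using nonneg[OF iter_closure[OF z(1)], of "Suc n"] by simp
    qed (simp add: z(2))
    have "isCont h w" using continuous_h by (simp add: continuous_on_eq_continuous_at)
    then have "(\<lambda>n. ?k ((\<gamma> i ^^ n) z)) \<longlonglongrightarrow> ?k w"
      by (intro tendsto_intros isCont_tendsto_compose[OF _ iter_lim])
    then show ?thesis unfolding zero by (simp add: LIMSEQ_const_iff)
  qed
  have compact: "compact (closure U)"
    using compact_T U_subset_T bounded_subset[OF compact_imp_bounded]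
    by (simp add: compact_closure)
  have cont: "continuous_on (closure U) h"
    using continuous_h by (rule continuous_on_subset) simp
  have ne: "closure U \<noteq> {}" using U_nonempty by simp
  obtain M where M: "M \<in> closure U" "\<And>y. y \<in> closure U \<Longrightarrow> h y \<le> h M"
    using continuous_attains_sup[OF compact ne cont] by blast
  obtain m where m: "m \<in> closure U" "\<And>y. y \<in> closure U \<Longrightarrow> h m \<le> h y"
    using continuous_attains_inf[OF compact ne cont] by blast
  \<comment> \<open>The two nonnegative functions are \<open>h M - h\<close> and, next,
    \<open>h - h m\<close>.\<close>
  have "h w = h M" using extremal[of "- 1" "h M" M] M by simp
  moreover have "h w = h m" using extremal[of 1 "- h m" m] m by simp
  ultimately have "h z = h w" if "z \<in> U" for z
    using M(2)[of z] m(2)[of z] that closure_subset[of U] by force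
  then show ?thesis by blast
qed

text \<open>Where \<open>h\<close> is the constant \<open>l\<close>, \<nu> is \<open>l\<close> times
  Lebesgue measure inside each box. The countable cover extends this to \<open>U\<close>, and
  \<open>T - U\<close> is null for both measures.\<close>

lemma multiple_of_lebesgue:
  assumes inv: invariant_on_boxes
  shows "\<exists>l\<ge>0. \<nu> = scale_measure (ennreal l) (restrict_space lborel T)"
proof -
  obtain l where l: "\<And>z. z \<in> U \<Longrightarrow> h z = l" using density_constant[OF inv] by blast
  have measure: "measure \<nu> E = l * measure lborel E"
    if "x \<in> T" "E \<in> sets borel" "E \<subseteq> Qbox 0 x" for x E
  proof -
    have "l * measure lborel E \<le> 1 * measure \<nu> E + 0 * measure lborel E"
      using that l by (intro linear_lower_bound[OF that]) (auto simp: U_def)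
    moreover have "- l * measure lborel E \<le> - 1 * measure \<nu> E + 0 * measure lborel E"
      using that l by (intro linear_lower_bound[OF that]) (auto simp: U_def)
    ultimately show ?thesis by simp
  qed
  \<comment> \<open>Some box has positive Lebesgue measure, while its \<nu>-mass is
    nonnegative.\<close>
  have "l \<ge> 0"
  proof -
    obtain z x where x: "x \<in> T" "\<forall>n. 0 \<le> z $ n \<and> z $ n < x $ n"
      using U_nonempty by (auto simp: U_def mem_Qbox_T)
    then have "0 < measure lborel (Qbox 0 x)"
      by (intro measure_Qbox_pos) (metis le_less_trans zero_index)
    moreover have "0 \<le> l * measure lborel (Qbox 0 x)"
      using measure[OF x(1) Qbox_T_borel[OF x(1)] order_refl] by (metis measure_nonneg)
    ultimately show ?thesis by (simp add: zero_le_mult_iff)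
  qed
  let ?M = "scale_measure (ennreal l) (restrict_space lborel T)"
  have sets_M: "sets ?M = sets \<nu>"
    unfolding sets_\<nu> sets_scale_measure sets_restrict_space sets_lborel ..
  have M: "emeasure ?M E = ennreal l * emeasure lborel E" if "E \<in> sets \<nu>" for E
    using that T_borel by (subst emeasure_scale_measure, subst emeasure_restrict_space) (auto simp: sets_\<nu>_iff)
  obtain C where C: "countable C" "C \<subseteq> T" "U = (\<Union>x\<in>C. Qbox 0 x)" by (rule countable_cover)
  have "\<nu> = ?M"
  proof (rule measure_eqI)
    show "sets \<nu> = sets ?M" by (rule sets_M[symmetric])
    fix E assume E: "E \<in> sets \<nu>"
    have U_sets: "E \<inter> U \<in> sets \<nu>" and Q_sets: "\<And>x. x \<in> T \<Longrightarrow> Qbox 0 x \<in> sets \<nu>"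
      using E U_borel Qbox_T_borel Qbox_subset_T by (auto simp: sets_\<nu>_iff)
    have TU_sets: "T - U \<in> sets \<nu>" using T_borel U_borel by (auto simp: sets_\<nu>_iff)
    have "emeasure \<nu> (E \<inter> U) = emeasure ?M (E \<inter> U)"
    proof (rule emeasure_eq_on_countable_cover[where C = C and B = "Qbox 0"])
      show "sets \<nu> = sets ?M" by (rule sets_M[symmetric])
      show "E \<inter> U \<subseteq> (\<Union>c\<in>C. Qbox 0 c)" using C(3) by auto
      fix x A assume x: "x \<in> C" and A: "A \<in> sets \<nu>" "A \<subseteq> Qbox 0 x"
      then have xT: "x \<in> T" and A_borel: "A \<in> sets borel" using C(2) by (auto simp: sets_\<nu>_iff)
      show "emeasure \<nu> A = emeasure ?M A"
        unfolding M[OF A(1)] emeasure_\<nu>_subset_Qbox[OF xT A(2)] emeasure_lborel_subset_Qbox[OF xT A(2)]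
          measure[OF xT A_borel A(2)]
        using \<open>l \<ge> 0\<close> by (simp add: ennreal_mult)
    qed (use C Q_sets U_sets in auto)
    moreover have inside: "emeasure N E = emeasure N (E \<inter> U)"
      if "sets N = sets \<nu>" "emeasure N (T - U) = 0" for N
    proof -
      have "T - U \<in> null_sets N" using that TU_sets by (simp add: null_sets_def)
      moreover have "E - U \<in> sets N" "E - U \<subseteq> T - U"
        using E U_borel that(1) by (auto simp: sets_\<nu>_iff)
      ultimately have "E - U \<in> null_sets N" by (metis null_sets_subset)
      then have "emeasure N ((E \<inter> U) \<union> (E - U)) = emeasure N (E \<inter> U)"
        using U_sets that(1) by (intro emeasure_Un_null_set) auto
      moreover have "(E \<inter> U) \<union> (E - U) = E" by auto
      ultimately show ?thesis by simp
    qed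
    moreover have "emeasure ?M (T - U) = 0"
      unfolding M[OF TU_sets] emeasure_T_minus_U by simp
    ultimately show "emeasure \<nu> E = emeasure ?M E"
      using inside[OF refl outer] inside[OF sets_M] by metis
  qed
  then show ?thesis using \<open>l \<ge> 0\<close> by blast
qed

text \<open>Passing from \<open>E\<close> to its image under \<open>\<gamma> i\<close> multiplies
  \<nu> by \<open>p i\<close>, and these factors sum to 1.\<close>

lemma lebesgue_invariant:
  assumes \<nu>: "\<nu> = scale_measure (ennreal l) (restrict_space lborel T)"
  shows "invariant_on T (gmap I \<gamma> T) \<nu>"
  unfolding invariant_on_def
proof (intro ballI impI)
  fix E :: "(real, 'n) vec set" assume E: "E \<in> sets borel" "E \<subseteq> T"
  have emeasure: "emeasure \<nu> E = ennreal l * emeasure lborel E" if "E \<in> sets borel" "E \<subseteq> T" for E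
    unfolding \<nu> using that T_borel by (subst emeasure_scale_measure, subst emeasure_restrict_space) auto
  have "emeasure \<nu> {x \<in> T. gmap I \<gamma> T x \<in> E} = (\<integral>\<^sup>+i. emeasure \<nu> (\<gamma> i ` E) \<partial>count_space I)"
    using E by (intro emeasure_gmap_preimage sets_\<nu> \<nu>_null)
  also have "\<dots> = (\<integral>\<^sup>+i. ennreal (p i) * emeasure \<nu> E \<partial>count_space I)"
  proof (rule nn_integral_cong)
    fix i assume "i \<in> space (count_space I)"
    then have i: "i \<in> I" by simp
    then have "\<gamma> i ` E \<subseteq> T" using E(2) \<gamma>_T by blast
    then show "emeasure \<nu> (\<gamma> i ` E) = ennreal (p i) * emeasure \<nu> E"
      using emeasure[OF \<gamma>_borel[OF i E(1)]] emeasure[OF E] emeasure_\<gamma>[OF i E(1)]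
      by (simp add: ac_simps)
  qed
  also have "\<dots> = emeasure \<nu> E"
    by (simp add: nn_integral_multc nn_integral_p)
  finally show "emeasure \<nu> E = emeasure \<nu> {x \<in> T. gmap I \<gamma> T x \<in> E}" by simp
qed

lemma invariant_imp_on_boxes:
  assumes "invariant_on T (gmap I \<gamma> T) \<nu>"
  shows invariant_on_boxes
  using assms Qbox_T_borel Qbox_subset_T by (simp add: invariant_on_boxes_def invariant_on_def)

end

theorem theorem11p1:
  fixes I :: "'i set"
    and \<gamma> :: "'i \<Rightarrow> (real, 'n::{finite,linorder}) vec \<Rightarrow> (real, 'n) vec"
    and \<alpha> a :: "'i \<Rightarrow> (real, 'n) vec"
    and T :: "(real, 'n) vec set"
    and \<nu> :: "(real, 'n) vec measure"
  assumes I: "countable I" "\<exists>i\<in>I. \<exists>j\<in>I. i \<noteq> j"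
    and H1: "\<And>i n. i \<in> I \<Longrightarrow> 0 < \<alpha> i $ n \<and> \<alpha> i $ n < 1"
      "(SUP (i, n)\<in>I \<times> UNIV. \<alpha> i $ n) < 1"
      "\<And>i x. i \<in> I \<Longrightarrow> \<gamma> i x = (\<chi> n. \<alpha> i $ n * x $ n + a i $ n)"
    and H2: "compact T" "admissible I \<gamma> T" "emeasure lborel T > 0"
      "\<And>i j. i \<in> I \<Longrightarrow> j \<in> I \<Longrightarrow> i \<noteq> j \<Longrightarrow> emeasure lborel (\<gamma> i ` T \<inter> \<gamma> j ` T) = 0"
      "emeasure lborel (sym_diff T (\<Union>i\<in>I. \<gamma> i ` T)) = 0"
      "T = closure (\<Union>i\<in>I. \<gamma> i ` T)"
    and H3: "\<And>x n. x \<in> T \<Longrightarrow> 0 \<le> x $ n" "\<And>x. x \<in> T \<Longrightarrow> Qbox 0 x \<subseteq> T"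
    and \<nu>: "CN_measure_on T \<nu>" "no_outer_mass T \<nu>"
  shows "(invariant_on T (gmap I \<gamma> T) \<nu> \<longleftrightarrow>
            Mop_converges I \<gamma> T (distrib \<nu>) \<and> (\<forall>x\<in>T. Mop I \<gamma> (distrib \<nu>) x = distrib \<nu> x))
       \<and> (Mop_converges I \<gamma> T (distrib \<nu>) \<and> (\<forall>x\<in>T. Mop I \<gamma> (distrib \<nu>) x = distrib \<nu> x) \<longleftrightarrow>
            (\<exists>l::real. l \<ge> 0 \<and> \<nu> = scale_measure (ennreal l) (restrict_space lborel T)))"
proof -
  interpret tiling T I \<gamma> \<alpha> a
    using I H1 H2 H3 by unfold_locales auto
  \<comment> \<open>Here \<open>h\<close> is the mixed partial derivative for
    \<open>M = UNIV\<close>.\<close>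
  obtain F h where F: "\<forall>x\<in>T. F x = distrib \<nu> x"
      "has_mixed_partial (sorted_list_of_set UNIV) F h" "continuous_on UNIV h"
    using \<nu>(1) unfolding CN_measure_on_def CN_function_on_def by blast
  interpret tiled_density T I \<gamma> \<alpha> a \<nu> F h
    using \<nu> F by unfold_locales (auto simp: CN_measure_on_def borel_measure_on_def no_outer_mass_def U_def)
  show ?thesis
    unfolding Mop_fixed_iff
    \<comment> \<open>With (ii) rewritten as \<open>invariant_on_boxes\<close>, the cycle is (ii) to
      (iii) to (i) to (ii).\<close>
    using multiple_of_lebesgue lebesgue_invariant invariant_imp_on_boxes by blast
qed

end
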